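(* Consider a sample of size $n$ from a Poisson/normal, a multinomial, or a negative-multinomial family on $\mathbb R^d$. If $\boldsymbol S$ denotes the sufficient statistic, then the (right) fiducial distribution for $\boldsymbol\phi$ has density $$h_{\boldsymbol s}(\boldsymbol\phi)=\prod_{k=1}^d h_{\boldsymbol s_{[k]}}(\phi_k)\propto\prod_{k=1}^d\exp\left\{\phi_k(s_k+z_k)-\left[n+q\left(\sum_{j=1}^{k-1}s_j-1\right)\right]B_k(\phi_k)\right\},$$ while for the negative-multinomial/gamma/normal family, with an $m$-dimensional negative-multinomial component, the (right) fiducial distribution is given by $$h_{\boldsymbol s}(\boldsymbol\phi)=\prod_{k=1}^d h_{\boldsymbol s_{[k]}}(\phi_k)\propto\prod_{k=1}^m\exp\{\phi_k(s_k+1)\}\,(1-\exp(\phi_k))^{n/q+\sum_{j=1}^{k-1}s_j-1}$$ $$\times\ \exp\{\phi_{m+1}s_{m+1}\}\,(-\phi_{m+1})^{n/q+\sum_{j=1}^m s_j-1}\ \times\prod_{k=m+2}^d\exp\left\{\phi_ks_k-n\,s_{m+1}\,\phi_k^2/2\right\}.$$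
   Context: Notation: $\boldsymbol v_{[k]}=(v_1,\dots,v_k)$; $\boldsymbol S=(S_1,\dots,S_d)$ is the vector of sample sums; empty sums are $0$. In each family the joint density of one observation $\boldsymbol X$ is a product over $k$ of the densities of $X_k$ given $\boldsymbol X_{[k-1]}=\boldsymbol x_{[k-1]}$, each a real natural exponential family with natural parameter $\phi_k$ (the $\phi_k$ being variation independent), as follows. (1) Poisson/normal (with $m$ Poisson components), $q=0$: independent components, $X_k$ Poisson with mean $e^{\phi_k}$, $z_k=1$, $B_k(\phi_k)=e^{\phi_k}$ for $k\le m$; $X_k$ normal with mean $\sigma^2\phi_k$ and known variance $\sigma^2$, $z_k=0$, $B_k(\phi_k)=\sigma^2\phi_k^2/2$ for $k>m$. (2) Multinomial with $N$ trials, $q=-1/N$: $X_k\mid\boldsymbol x_{[k-1]}$ is binomial with $N-\sum_{j<k}x_j$ trials and success probability $e^{\phi_k}/(1+e^{\phi_k})$, $\phi_k\in\mathbb R$; $z_k=1$, $B_k(\phi_k)=N\log(1+e^{\phi_k})$. (3) Negative-multinomial with $R$ occurrences in the $(d+1)$-th cell ($R$ a positive integer), $q=1/R$: $X_k\mid\boldsymbol x_{[k-1]}$ has mass function on $\{0,1,2,\dots\}$ equal to $\binom{r+x-1}{x}e^{\phi_kx}(1-e^{\phi_k})^{r}$ with $r=R+\sum_{j<k}x_j$, $\phi_k<0$; $z_k=1$, $B_k(\phi_k)=-R\log(1-e^{\phi_k})$. (4) Negative-multinomial/gamma/normal, $q=1/R$: $(X_1,\dots,X_m)$ is negative-multinomial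 as in (3), with $R$ occurrences in the $(m+1)$-th cell; $X_{m+1}\mid\boldsymbol x_{[m]}$ is gamma with shape $R+\sum_{j=1}^m x_j$ and rate $-\phi_{m+1}$, $\phi_{m+1}<0$; for $k=m+2,\dots,d$, $X_k\mid\boldsymbol x_{[k-1]}$ is normal with mean $\phi_kx_{m+1}$ and variance $x_{m+1}$, $\phi_k\in\mathbb R$. The (right) fiducial density of $\boldsymbol\phi$ given $\boldsymbol S=\boldsymbol s$ is $h_{\boldsymbol s}(\boldsymbol\phi)=\prod_{k=1}^d h_{\boldsymbol s_{[k]}}(\phi_k)$ with $h_{\boldsymbol s_{[k]}}(\phi_k)=-\frac{\partial}{\partial\phi_k}\Pr_{\phi_k}\{S_k\le s_k\mid\boldsymbol S_{[k-1]}=\boldsymbol s_{[k-1]}\}$. The observed $\boldsymbol s$ is assumed to be such that each factor is defined: for each $k$, with $a_k,b_k$ the infimum and supremum of the support of the conditional distribution of $S_k$ given $\boldsymbol S_{[k-1]}=\boldsymbol s_{[k-1]}$, $s_k$ (in the support) lies in $[a_k,b_k)$ if $a_k$ has positive mass and in $(a_k,b_k)$ otherwise.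
   Formalization: In the last product, for k=m+2,…,d, the exponent is φ_k s_k − s_{m+1}φ_k²/2 instead of φ_k s_k − n s_{m+1}φ_k²/2: given the earlier sums, S_k is normal with mean φ_k s_{m+1} and variance s_{m+1}, so the printed factor n is wrong for n ≥ 2. *)

theory Defs
  imports "HOL-Probability.Probability"
begin

text \<open>
  \<open>Poisson_Normal m \<sigma>\<close>: \<open>m\<close> Poisson components, known variance \<open>\<sigma>\<^sup>2\<close> of the normal ones.
  \<open>Multinomial N\<close>: \<open>N\<close> trials.
  \<open>Neg_Multinomial R\<close>: \<open>R\<close> occurrences in the cell \<open>d + 1\<close>.
  \<open>NM_Gamma_Normal m R\<close>: \<open>m\<close>-dimensional negative-multinomial part, with \<open>R\<close> occurrences in
  the cell \<open>m + 1\<close>.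
  Observations and natural parameters are functions \<open>nat \<Rightarrow> real\<close> on the index set \<open>{1..d}\<close>.
\<close>

datatype family =
    Poisson_Normal nat real
  | Multinomial nat
  | Neg_Multinomial nat
  | NM_Gamma_Normal nat nat

fun valid_family :: "nat \<Rightarrow> family \<Rightarrow> bool" where
  "valid_family d (Poisson_Normal m \<sigma>) \<longleftrightarrow> m \<le> d \<and> 0 < \<sigma>"
| "valid_family d (Multinomial N) \<longleftrightarrow> 1 \<le> N"
| "valid_family d (Neg_Multinomial R) \<longleftrightarrow> 1 \<le> R"
| "valid_family d (NM_Gamma_Normal m R) \<longleftrightarrow> m + 1 \<le> d \<and> 1 \<le> R"

text \<open>The range of the \<open>k\<close>-th natural parameter.\<close>

fun par_range :: "family \<Rightarrow> nat \<Rightarrow> real set" where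
  "par_range (Poisson_Normal m \<sigma>) k = UNIV"
| "par_range (Multinomial N) k = UNIV"
| "par_range (Neg_Multinomial R) k = {..<0}"
| "par_range (NM_Gamma_Normal m R) k = (if k \<le> m + 1 then {..<0} else UNIV)"

definition par_space :: "nat \<Rightarrow> family \<Rightarrow> (nat \<Rightarrow> real) set" where
  "par_space d F = (\<Pi>\<^sub>E k\<in>{1..d}. par_range F k)"

text \<open>Counting measure on the naturals, as a measure on the real line.\<close>

definition count_nat :: "real measure" where
  "count_nat = distr (count_space UNIV) borel (real :: nat \<Rightarrow> real)"

fun ref_measure :: "family \<Rightarrow> nat \<Rightarrow> real measure" where
  "ref_measure (Poisson_Normal m \<sigma>) k = (if k \<le> m then count_nat else lborel)"
| "ref_measure (Multinomial N) k = count_nat"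
| "ref_measure (Neg_Multinomial R) k = count_nat"
| "ref_measure (NM_Gamma_Normal m R) k = (if k \<le> m then count_nat else lborel)"

definition prefix_sum :: "(nat \<Rightarrow> real) \<Rightarrow> nat \<Rightarrow> real" where
  "prefix_sum x k = (\<Sum>j=1..<k. x j)"

text \<open>
  \<open>cond_density F k t x\<close> is the density (with respect to \<open>ref_measure F k\<close>), at the point \<open>x k\<close>,
  of the \<open>k\<close>-th component given the components \<open>x 1, \<dots>, x (k - 1)\<close>, for the natural
  parameter \<open>\<phi> k = t\<close>. The maps \<open>nat \<lfloor>_\<rfloor>\<close> are applied to values that are almost everywhere
  natural numbers. \<open>neg_binomial_pmf r p\<close> has mass \<open>(r + y - 1 choose y) * p ^ r * (1 - p) ^ y\<close>;
  \<open>erlang_density a l\<close> is the gamma density with shape \<open>a + 1\<close> and rate \<open>l\<close>; the second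
  argument of \<open>normal_density\<close> is the standard deviation.
\<close>

fun cond_density :: "family \<Rightarrow> nat \<Rightarrow> real \<Rightarrow> (nat \<Rightarrow> real) \<Rightarrow> real" where
  "cond_density (Poisson_Normal m \<sigma>) k t x =
     (if k \<le> m then pmf (poisson_pmf (exp t)) (nat \<lfloor>x k\<rfloor>)
      else normal_density (\<sigma>\<^sup>2 * t) \<sigma> (x k))"
| "cond_density (Multinomial N) k t x =
     pmf (binomial_pmf (nat \<lfloor>real N - prefix_sum x k\<rfloor>) (exp t / (1 + exp t))) (nat \<lfloor>x k\<rfloor>)"
| "cond_density (Neg_Multinomial R) k t x =
     pmf (neg_binomial_pmf (R + nat \<lfloor>prefix_sum x k\<rfloor>) (1 - exp t)) (nat \<lfloor>x k\<rfloor>)"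
| "cond_density (NM_Gamma_Normal m R) k t x =
     (if k \<le> m then
        pmf (neg_binomial_pmf (R + nat \<lfloor>prefix_sum x k\<rfloor>) (1 - exp t)) (nat \<lfloor>x k\<rfloor>)
      else if k = m + 1 then
        erlang_density (R + nat \<lfloor>prefix_sum x k\<rfloor> - 1) (- t) (x k)
      else
        normal_density (t * x (m + 1)) (sqrt (x (m + 1))) (x k))"

definition obs_law :: "nat \<Rightarrow> family \<Rightarrow> (nat \<Rightarrow> real) \<Rightarrow> (nat \<Rightarrow> real) measure" where
  "obs_law d F \<phi> =
     density (\<Pi>\<^sub>M k\<in>{1..d}. ref_measure F k) (\<lambda>x. ennreal (\<Prod>k=1..d. cond_density F k (\<phi> k) x))"

text \<open>The law of an i.i.d.\ sample of size \<open>n\<close>, and the vector of sample sums.\<close>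

definition sample_law :: "nat \<Rightarrow> nat \<Rightarrow> family \<Rightarrow> (nat \<Rightarrow> real) \<Rightarrow> (nat \<Rightarrow> nat \<Rightarrow> real) measure" where
  "sample_law n d F \<phi> = (\<Pi>\<^sub>M i\<in>{1..n}. obs_law d F \<phi>)"

definition sample_sum :: "nat \<Rightarrow> nat \<Rightarrow> (nat \<Rightarrow> nat \<Rightarrow> real) \<Rightarrow> real" where
  "sample_sum n k \<omega> = (\<Sum>i=1..n. \<omega> i k)"

text \<open>
  \<open>prob_given M S k s A\<close> is the conditional probability of \<open>S k \<in> A\<close> given
  \<open>S 1 = s 1, \<dots>, S (k - 1) = s (k - 1)\<close>. As the conditioning event may be null, it is taken as
  the limit over shrinking neighbourhoods of the conditioning point. This is the elementary
  conditional probability if the conditioning variables are integer-valued, and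
  otherwise selects, at every point, the continuous version of the regular conditional
  distribution; an almost-everywhere version would not do, since the value at a fixed \<open>s\<close>
  is to be differentiated with respect to the parameter.
\<close>

definition prob_given ::
    "'w measure \<Rightarrow> (nat \<Rightarrow> 'w \<Rightarrow> real) \<Rightarrow> nat \<Rightarrow> (nat \<Rightarrow> real) \<Rightarrow> real set \<Rightarrow> real" where
  "prob_given M S k s A =
     Lim (at_right 0) (\<lambda>\<epsilon>.
       cond_prob M (\<lambda>\<omega>. S k \<omega> \<in> A) (\<lambda>\<omega>. \<forall>j\<in>{1..<k}. \<bar>S j \<omega> - s j\<bar> < \<epsilon>))"

definition S_given ::
    "nat \<Rightarrow> nat \<Rightarrow> family \<Rightarrow> (nat \<Rightarrow> real) \<Rightarrow> nat \<Rightarrow> (nat \<Rightarrow> real) \<Rightarrow> real set \<Rightarrow> real" where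
  "S_given n d F \<phi> k s A = prob_given (sample_law n d F \<phi>) (sample_sum n) k s A"

definition cond_support ::
    "nat \<Rightarrow> nat \<Rightarrow> family \<Rightarrow> (nat \<Rightarrow> real) \<Rightarrow> nat \<Rightarrow> (nat \<Rightarrow> real) \<Rightarrow> real set" where
  "cond_support n d F \<phi> k s = {t. \<forall>\<delta>>0. 0 < S_given n d F \<phi> k s {t - \<delta><..<t + \<delta>}}"

text \<open>The standing assumption on the observed value \<open>s\<close> of the sample sums.\<close>

definition admissible :: "nat \<Rightarrow> nat \<Rightarrow> family \<Rightarrow> (nat \<Rightarrow> real) \<Rightarrow> bool" where
  "admissible n d F s \<longleftrightarrow>
     (\<forall>\<phi>\<in>par_space d F. \<forall>k\<in>{1..d}.
        let a = Inf (ereal ` cond_support n d F \<phi> k s);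
            b = Sup (ereal ` cond_support n d F \<phi> k s)
        in s k \<in> cond_support n d F \<phi> k s \<and>
           (if 0 < S_given n d F \<phi> k s {x. ereal x = a}
            then a \<le> ereal (s k) \<and> ereal (s k) < b
            else a < ereal (s k) \<and> ereal (s k) < b))"

text \<open>
  \<open>cond_cdf n d F s k \<phi> t\<close> is the conditional probability of \<open>S k \<le> s k\<close> given
  \<open>S 1 = s 1, \<dots>, S (k - 1) = s (k - 1)\<close> when the \<open>k\<close>-th parameter is \<open>t\<close> and the others
  are those of \<open>\<phi>\<close>.
\<close>

definition cond_cdf ::
    "nat \<Rightarrow> nat \<Rightarrow> family \<Rightarrow> (nat \<Rightarrow> real) \<Rightarrow> nat \<Rightarrow> (nat \<Rightarrow> real) \<Rightarrow> real \<Rightarrow> real" where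
  "cond_cdf n d F s k \<phi> t = S_given n d F (\<phi>(k := t)) k s {..s k}"

definition fiducial_factor ::
    "nat \<Rightarrow> nat \<Rightarrow> family \<Rightarrow> (nat \<Rightarrow> real) \<Rightarrow> nat \<Rightarrow> (nat \<Rightarrow> real) \<Rightarrow> real" where
  "fiducial_factor n d F s k \<phi> = - deriv (cond_cdf n d F s k \<phi>) (\<phi> k)"

definition fiducial_density ::
    "nat \<Rightarrow> nat \<Rightarrow> family \<Rightarrow> (nat \<Rightarrow> real) \<Rightarrow> (nat \<Rightarrow> real) \<Rightarrow> real" where
  "fiducial_density n d F s \<phi> = (\<Prod>k=1..d. fiducial_factor n d F s k \<phi>)"

definition fiducial_distribution ::
    "nat \<Rightarrow> nat \<Rightarrow> family \<Rightarrow> (nat \<Rightarrow> real) \<Rightarrow> (nat \<Rightarrow> real) measure" where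
  "fiducial_distribution n d F s =
     density (\<Pi>\<^sub>M k\<in>{1..d}. lborel)
       (\<lambda>\<phi>. ennreal (fiducial_density n d F s \<phi>) * indicator (par_space d F) \<phi>)"

text \<open>
  The factors are well defined: the conditional probabilities depend on the
  \<open>k\<close>-th parameter only, and they are differentiable in it.
\<close>

definition fiducial_well_defined :: "nat \<Rightarrow> nat \<Rightarrow> family \<Rightarrow> (nat \<Rightarrow> real) \<Rightarrow> bool" where
  "fiducial_well_defined n d F s \<longleftrightarrow>
     (\<forall>k\<in>{1..d}. \<forall>\<phi>\<in>par_space d F. \<forall>t\<in>par_range F k.
        (\<forall>\<phi>'\<in>par_space d F. cond_cdf n d F s k \<phi>' t = cond_cdf n d F s k \<phi> t) \<and>
        cond_cdf n d F s k \<phi> differentiable (at t))"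

definition proportional_on :: "'a set \<Rightarrow> ('a \<Rightarrow> real) \<Rightarrow> ('a \<Rightarrow> real) \<Rightarrow> bool" where
  "proportional_on A f g \<longleftrightarrow> (\<exists>c>0. \<forall>x\<in>A. f x = c * g x)"

definition is_NM_Gamma_Normal :: "family \<Rightarrow> bool" where
  "is_NM_Gamma_Normal F \<longleftrightarrow> (\<exists>m R. F = NM_Gamma_Normal m R)"

text \<open>
  The constants \<open>q\<close>, \<open>z k\<close> and the functions \<open>B k\<close>. The last two have no role for
  \<open>NM_Gamma_Normal\<close>, where they get a dummy value: the density then has another form.
\<close>

fun q_const :: "family \<Rightarrow> real" where
  "q_const (Poisson_Normal m \<sigma>) = 0"
| "q_const (Multinomial N) = - 1 / real N"
| "q_const (Neg_Multinomial R) = 1 / real R"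
| "q_const (NM_Gamma_Normal m R) = 1 / real R"

fun z_const :: "family \<Rightarrow> nat \<Rightarrow> real" where
  "z_const (Poisson_Normal m \<sigma>) k = (if k \<le> m then 1 else 0)"
| "z_const (Multinomial N) k = 1"
| "z_const (Neg_Multinomial R) k = 1"
| "z_const (NM_Gamma_Normal m R) k = 0"

fun B_fun :: "family \<Rightarrow> nat \<Rightarrow> real \<Rightarrow> real" where
  "B_fun (Poisson_Normal m \<sigma>) k t = (if k \<le> m then exp t else \<sigma>\<^sup>2 * t\<^sup>2 / 2)"
| "B_fun (Multinomial N) k t = real N * ln (1 + exp t)"
| "B_fun (Neg_Multinomial R) k t = - real R * ln (1 - exp t)"
| "B_fun (NM_Gamma_Normal m R) k t = 0"

text \<open>
  Coefficients of the quadratic terms of the fiducial density for \<open>NM_Gamma_Normal m R\<close>: for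
  \<open>k \<ge> m + 2\<close>, given the sample of the \<open>(m + 1)\<close>-th components, \<open>S k\<close> is normal with mean
  \<open>\<phi> k * S (m + 1)\<close> and variance \<open>S (m + 1)\<close>, where \<open>S (m + 1)\<close> is a sample sum. So the
  coefficient of \<open>- (\<phi> k)\<^sup>2 / 2\<close> in the exponent is \<open>s (m + 1)\<close>. It is found in print as
  \<open>n * s (m + 1)\<close>, which is correct only for \<open>n = 1\<close>.
\<close>

end

theory Submission
  imports Defs
begin

text \<open>
  Every family is a chain of one-parameter exponential families that are closed under convolution:
  given the preceding components, a component is Poisson, binomial, negative binomial, gamma or normal,
  and the parameter \<open>c\<close> that adds up under convolution is an affine function of the preceding components
  (\<open>shape\<close>). Hence for a sample of size \<open>n\<close>, conditionally on all
  preceding components of all observations, the \<open>k\<close>-th sum is again of that type, with \<open>c\<close> summed over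
  the sample. By affinity this value depends on the preceding sums only, so it is also the parameter of the
  conditional law of \<open>S k\<close> given the preceding sums (\<open>nef_convolution\<close>, \<open>iid_sum_disintegration\<close>,
  \<open>sample_sum_disintegration\<close>). The number of trials left, \<open>n N\<close> minus the preceding sums, is the
  typical example.

  The conditional probabilities are limits of elementary ones over shrinking neighbourhoods.
  They equal the kernel at the conditioning point, because the kernel is continuous in \<open>c\<close> and admissibility
  excludes null neighbourhoods (\<open>S_given_eq_nef_law\<close>, \<open>admissible_near_pos\<close>). In particular
  the \<open>k\<close>-th conditional distribution function involves the \<open>k\<close>-th natural parameter \<open>t\<close> alone.

  What remains is calculus in one variable. For a discrete law the derivative in \<open>t\<close> of the
  distribution function at \<open>y\<close> is a telescoping sum, of which only the boundary term survives, and for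
  the gamma law it is of the same form by the duality between waiting times and Poisson counts;
  for the normal law it is a value of the density times a Jacobian. In each case one gets minus a
  positive constant times \<open>nef_fid\<close>. Finally, the distribution function at \<open>y\<close> runs from 1 to 0 as \<open>t\<close> runs
  through its range, so that each factor integrates to 1 (\<open>nef_fiducial\<close>) and the fiducial density is a
  product of probability densities.
\<close>

section \<open>Five exponential convolution semigroups\<close>

text \<open>
  The five one-parameter exponential families that occur as conditional laws: Poisson, binomial,
  negative binomial, gamma, normal. In \<open>nef_law \<kappa> c t\<close> the natural parameter is \<open>t\<close>, and \<open>c\<close> is
  the convolution parameter: the intensity at \<open>t = 0\<close>, the number of trials, the number of
  occurrences, the gamma shape, and the variance (the normal law has mean \<open>c t\<close>). For the four
  families with integer parameter, \<open>c\<close> is nevertheless a real number, because it arises as an affine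
  function of real-valued observations.
\<close>

datatype nef = Poi | Bin | NegBin | Gam | Norm

definition nat_law :: "nat pmf \<Rightarrow> real measure" where
  "nat_law p = distr (measure_pmf p) borel real"

fun nef_law :: "nef \<Rightarrow> real \<Rightarrow> real \<Rightarrow> real measure" where
  "nef_law Poi c t = nat_law (poisson_pmf (real (nat \<lfloor>c\<rfloor>) * exp t))"
| "nef_law Bin c t = nat_law (binomial_pmf (nat \<lfloor>c\<rfloor>) (exp t / (1 + exp t)))"
| "nef_law NegBin c t = nat_law (neg_binomial_pmf (nat \<lfloor>c\<rfloor>) (1 - exp t))"
| "nef_law Gam c t = density lborel (\<lambda>y. ennreal (erlang_density (nat \<lfloor>c\<rfloor> - 1) (- t) y))"
| "nef_law Norm c t = density lborel (\<lambda>y. ennreal (normal_density (c * t) (sqrt c) y))"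

fun nef_pars :: "nef \<Rightarrow> real set" where
  "nef_pars Poi = UNIV"
| "nef_pars Bin = UNIV"
| "nef_pars NegBin = {..<0}"
| "nef_pars Gam = {..<0}"
| "nef_pars Norm = UNIV"

text \<open>
  Poisson and negative binomial laws with \<open>c = 0\<close> are left out, as they are degenerate.
  The degenerate binomial law stays: a multinomial observation may use up all its trials
  in the first cells.
\<close>

fun nef_shapes :: "nef \<Rightarrow> real set" where
  "nef_shapes Poi = {c \<in> \<nat>. 1 \<le> c}"
| "nef_shapes Bin = \<nat>"
| "nef_shapes NegBin = {c \<in> \<nat>. 1 \<le> c}"
| "nef_shapes Gam = {c \<in> \<nat>. 1 \<le> c}"
| "nef_shapes Norm = {0<..}"

lemma sets_nat_law [simp, measurable_cong]: "sets (nat_law p) = sets borel"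
  by (simp add: nat_law_def)

lemma prob_space_nat_law: "prob_space (nat_law p)"
  unfolding nat_law_def by (rule measure_pmf.prob_space_distr) simp

lemma nn_integral_nat_law:
  assumes [measurable]: "f \<in> borel_measurable borel"
  shows "(\<integral>\<^sup>+y. f y \<partial>nat_law p) = (\<integral>\<^sup>+i. f (real i) \<partial>measure_pmf p)"
  unfolding nat_law_def by (subst nn_integral_distr) auto

text \<open>
  This ties the mass functions, which the families take at \<open>nat \<lfloor>_\<rfloor>\<close> of a real argument and
  as densities with respect to the counting measure, to laws on the real line.
\<close>

lemma nat_law_eq_density: "nat_law p = density count_nat (\<lambda>y. ennreal (pmf p (nat \<lfloor>y\<rfloor>)))"
proof (rule measure_eqI)
  fix A assume "A \<in> sets (nat_law p)"
  then have [measurable]: "A \<in> sets borel" by simp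
  have m[measurable]: "(\<lambda>y::real. ennreal (pmf p (nat \<lfloor>y\<rfloor>))) \<in> borel_measurable borel"
    by measurable
  have "emeasure (density count_nat (\<lambda>y. ennreal (pmf p (nat \<lfloor>y\<rfloor>)))) A
      = (\<integral>\<^sup>+y. ennreal (pmf p (nat \<lfloor>y\<rfloor>)) * indicator A y \<partial>count_nat)"
    by (subst emeasure_density) (auto simp: count_nat_def)
  also have "\<dots> = (\<integral>\<^sup>+i. ennreal (pmf p i) * indicator A (real i) \<partial>count_space UNIV)"
    unfolding count_nat_def by (subst nn_integral_distr) auto
  also have "\<dots> = (\<integral>\<^sup>+i. indicator A (real i) \<partial>measure_pmf p)"
    by (simp add: nn_integral_measure_pmf)
  also have "\<dots> = emeasure (nat_law p) A"
    by (simp add: nn_integral_nat_law[symmetric])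
  finally show "emeasure (nat_law p) A = emeasure (density count_nat (\<lambda>y. ennreal (pmf p (nat \<lfloor>y\<rfloor>)))) A"
    by simp
qed (simp add: count_nat_def)

lemma measure_nat_law_atMost: "measure (nat_law p) {..real y} = measure (measure_pmf p) {..y}"
  unfolding nat_law_def by (subst measure_distr) (auto simp: vimage_def atMost_def)

lemma nat_law_null:
  assumes "A \<in> sets borel" "\<And>i. i \<in> set_pmf p \<Longrightarrow> real i \<notin> A"
  shows "measure (nat_law p) A = 0"
  unfolding nat_law_def using assms
  by (subst measure_distr) (auto simp: measure_pmf_zero_iff)

lemma convolution_nat_law:
  "(nat_law p \<star> nat_law q) = nat_law (bind_pmf p (\<lambda>i. map_pmf ((+) i) q))"
proof (rule measure_eqI)
  fix A assume "A \<in> sets (nat_law p \<star> nat_law q)"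
  then have [measurable]: "A \<in> sets borel" by simp
  interpret p: prob_space "nat_law p" by (rule prob_space_nat_law)
  interpret q: prob_space "nat_law q" by (rule prob_space_nat_law)
  have "emeasure (nat_law p \<star> nat_law q) A = (\<integral>\<^sup>+x. \<integral>\<^sup>+y. indicator A (x + y) \<partial>nat_law q \<partial>nat_law p)"
    by (rule convolution_emeasure') (auto intro: p.finite_measure_axioms q.finite_measure_axioms)
  also have "\<dots> = (\<integral>\<^sup>+i. \<integral>\<^sup>+y. indicator A (real i + y) \<partial>nat_law q \<partial>measure_pmf p)"
    by (rule nn_integral_nat_law) measurable
  also have "\<dots> = (\<integral>\<^sup>+i. \<integral>\<^sup>+j. indicator A (real (i + j)) \<partial>measure_pmf q \<partial>measure_pmf p)"
    by (intro nn_integral_cong) (subst nn_integral_nat_law, auto)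
  also have "\<dots> = (\<integral>\<^sup>+k. indicator A (real k) \<partial>measure_pmf (bind_pmf p (\<lambda>i. map_pmf ((+) i) q)))"
    by simp
  also have "\<dots> = (\<integral>\<^sup>+y. indicator A y \<partial>nat_law (bind_pmf p (\<lambda>i. map_pmf ((+) i) q)))"
    by (simp add: nn_integral_nat_law del: nn_integral_indicator)
  finally show "emeasure (nat_law p \<star> nat_law q) A
      = emeasure (nat_law (bind_pmf p (\<lambda>i. map_pmf ((+) i) q))) A"
    by simp
qed simp

text \<open>
  Pooling the trials of two independent experiments; the next two lemmas are the analogues for
  the waiting times and for the Poisson counts.
\<close>

lemma binomial_pmf_add:
  assumes "p \<in> {0..1}"
  shows "bind_pmf (binomial_pmf m p) (\<lambda>i. map_pmf ((+) i) (binomial_pmf n p)) = binomial_pmf (m + n) p"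
proof (induction m)
  case 0
  then show ?case using assms by (simp add: binomial_pmf_0 bind_return_pmf map_pmf_def bind_return_pmf')
next
  case (Suc m)
  show ?case
    using assms
    by (simp add: binomial_pmf_Suc Suc.IH[symmetric] map_pmf_def bind_assoc_pmf bind_return_pmf ac_simps)
qed

lemma neg_binomial_pmf_add:
  "bind_pmf (neg_binomial_pmf m p) (\<lambda>i. map_pmf ((+) i) (neg_binomial_pmf n p)) = neg_binomial_pmf (m + n) p"
proof (induction m)
  case 0
  then show ?case by (simp add: bind_return_pmf map_pmf_def bind_return_pmf')
next
  case (Suc m)
  show ?case
    by (simp add: neg_binomial_pmf_Suc Suc.IH[symmetric] map_pmf_def bind_assoc_pmf bind_return_pmf
         pair_pmf_def ac_simps)
qed

lemma poisson_pmf_add: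
  assumes "0 < a" "0 < b"
  shows "bind_pmf (poisson_pmf a) (\<lambda>i. map_pmf ((+) i) (poisson_pmf b)) = poisson_pmf (a + b)"
proof (rule pmf_eqI)
  fix k
  have m: "measure (measure_pmf (poisson_pmf b)) {j. i + j = k} = (if i \<le> k then pmf (poisson_pmf b) (k - i) else 0)"
    for i
  proof (cases "i \<le> k")
    case True
    then have "{j. i + j = k} = {k - i}" by auto
    then show ?thesis using True by (simp add: measure_pmf_single)
  next
    case False
    then have "{j. i + j = k} = {}" by auto
    then show ?thesis using False by simp
  qed
  have "pmf (bind_pmf (poisson_pmf a) (\<lambda>i. map_pmf ((+) i) (poisson_pmf b))) k
      = (\<integral>i. (if i \<le> k then pmf (poisson_pmf b) (k - i) else 0) \<partial>measure_pmf (poisson_pmf a))"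
    by (simp add: pmf_bind pmf_map vimage_def m[symmetric])
  also have "\<dots> = (\<Sum>i\<in>{..k}. (if i \<le> k then pmf (poisson_pmf b) (k - i) else 0) * pmf (poisson_pmf a) i)"
    by (subst integral_measure_pmf_real[where A = "{..k}"]) (auto split: if_splits)
  also have "\<dots> = (\<Sum>i\<le>k. real (k choose i) * a ^ i * b ^ (k - i)) / fact k * exp (-(a + b))"
    unfolding sum_divide_distrib sum_distrib_right
  proof (rule sum.cong)
    fix i assume i: "i \<in> {..k}"
    then have "real (k choose i) = fact k / (fact i * fact (k - i))"
      using binomial_fact by (metis atMost_iff)
    then show "(if i \<le> k then pmf (poisson_pmf b) (k - i) else 0) * pmf (poisson_pmf a) i
       = real (k choose i) * a ^ i * b ^ (k - i) / fact k * exp (-(a + b))"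
      using i assms by (simp add: exp_diff exp_minus field_simps exp_add)
  qed simp
  also have "\<dots> = pmf (poisson_pmf (a + b)) k"
    using assms by (simp add: binomial_ring[of a b k, unfolded atLeast0AtMost])
  finally show "pmf (bind_pmf (poisson_pmf a) (\<lambda>i. map_pmf ((+) i) (poisson_pmf b))) k
      = pmf (poisson_pmf (a + b)) k" .
qed

text \<open>
  Both means are moved to the origin by a translation, which reduces the claim to the centred case.
\<close>

lemma convolution_normal:
  assumes [arith]: "0 < v" "0 < w"
  shows "(density lborel (\<lambda>y. ennreal (normal_density a (sqrt v) y)) \<star>
          density lborel (\<lambda>y. ennreal (normal_density b (sqrt w) y)))
         = density lborel (\<lambda>y. ennreal (normal_density (a + b) (sqrt (v + w)) y))"
proof -
  have shift: "normal_density m s x = normal_density 0 s (x - m)" for m s x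
    by (simp add: normal_density_def)
  have "(\<integral>\<^sup>+y. ennreal (normal_density a (sqrt v) (x - y)) * ennreal (normal_density b (sqrt w) y) \<partial>lborel)
      = ennreal (normal_density (a + b) (sqrt (v + w)) x)" for x
  proof -
    have "(\<integral>\<^sup>+y. ennreal (normal_density a (sqrt v) (x - y)) * ennreal (normal_density b (sqrt w) y) \<partial>lborel)
      = (\<integral>\<^sup>+y. ennreal (normal_density 0 (sqrt v) ((x - a - b) - y) * normal_density 0 (sqrt w) y) \<partial>lborel)"
      by (subst nn_integral_real_affine[where c = 1 and t = b])
         (auto simp: shift[of a] shift[of b] ennreal_mult algebra_simps)
    also have "\<dots> = ennreal (normal_density 0 (sqrt ((sqrt v)\<^sup>2 + (sqrt w)\<^sup>2)) (x - a - b))"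
      using conv_normal_density_zero_mean[of "sqrt v" "sqrt w"] by (auto dest: fun_cong)
    finally show ?thesis by (simp add: shift[of "a + b"] diff_diff_eq)
  qed
  then show ?thesis
    by (subst convolution_density)
       (auto intro!: prob_space.axioms(1)[OF prob_space_normal_density])
qed

lemma nat_floor_add:
  assumes "c \<in> \<nat>" "c' \<in> \<nat>"
  shows "nat \<lfloor>c + c'\<rfloor> = nat \<lfloor>c\<rfloor> + nat \<lfloor>c' :: real\<rfloor>"
  using assms by (auto simp: Nats_def nat_add_distrib)

lemma sets_nef_law [simp, measurable_cong]: "sets (nef_law \<kappa> c t) = sets borel"
  by (cases \<kappa>) simp_all

lemma space_nef_law [simp]: "space (nef_law \<kappa> c t) = UNIV"
  using sets_eq_imp_space_eq[OF sets_nef_law, of \<kappa> c t] by simp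

lemma nef_prob_space:
  assumes "t \<in> nef_pars \<kappa>" "c \<in> nef_shapes \<kappa>"
  shows "prob_space (nef_law \<kappa> c t)"
  using assms
  by (cases \<kappa>) (auto intro!: prob_space_nat_law prob_space_erlang_density prob_space_normal_density)

lemma nef_shapes_add:
  "c \<in> nef_shapes \<kappa> \<Longrightarrow> c' \<in> nef_shapes \<kappa> \<Longrightarrow> c + c' \<in> nef_shapes \<kappa>"
  by (cases \<kappa>) auto

text \<open>
  The convolution semigroup property. It is what makes the conditional law of a sample sum depend on
  the earlier observations through their sums only.
\<close>

lemma nef_convolution:
  assumes t: "t \<in> nef_pars \<kappa>" and c: "c \<in> nef_shapes \<kappa>" "c' \<in> nef_shapes \<kappa>"
  shows "(nef_law \<kappa> c t \<star> nef_law \<kappa> c' t) = nef_law \<kappa> (c + c') t"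
proof (cases \<kappa>)
  case Poi
  then have p: "0 < real (nat \<lfloor>c\<rfloor>) * exp t" "0 < real (nat \<lfloor>c'\<rfloor>) * exp t"
    using c by auto
  show ?thesis using poisson_pmf_add[OF p] Poi c
    by (simp add: convolution_nat_law nat_floor_add distrib_right)
next
  case Bin
  have "exp t / (1 + exp t) \<in> {0..1}" by (simp add: field_simps add_pos_pos add_nonneg_nonneg)
  then show ?thesis using Bin c by (simp add: convolution_nat_law nat_floor_add binomial_pmf_add)
next
  case NegBin
  then show ?thesis using c by (simp add: convolution_nat_law nat_floor_add neg_binomial_pmf_add)
next
  case Gam
  then have [simp]: "t < 0" using t by simp
  obtain m m' where m: "nat \<lfloor>c\<rfloor> = Suc m" "nat \<lfloor>c'\<rfloor> = Suc m'"
    using c Gam by (auto simp: Nats_def) (metis Suc_pred' less_eq_Suc_le One_nat_def)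
  have "prob_space (density lborel (\<lambda>y. ennreal (erlang_density k (- t) y)))" for k
    by (rule prob_space_erlang_density) simp
  then have "(density lborel (\<lambda>y. ennreal (erlang_density m (- t) y)) \<star>
       density lborel (\<lambda>y. ennreal (erlang_density m' (- t) y)))
    = density lborel (\<lambda>y. ennreal (erlang_density (Suc m + Suc m' - 1) (- t) y))"
    by (subst convolution_density)
       (auto intro: prob_space.axioms(1) simp: convolution_erlang_density[of "- t" m m', simplified])
  then show ?thesis using Gam c m by (simp add: nat_floor_add)
next
  case Norm
  then show ?thesis using c convolution_normal[of c c' "c * t" "c' * t"] by (simp add: distrib_right)
qed

section \<open>Dependence on the convolution parameter\<close>

text \<open>
  Measurability in the convolution parameter, for all real \<open>c\<close>: a discrete law factors through
  \<open>nat \<lfloor>c\<rfloor>\<close>, and for \<open>c \<le> 0\<close> the normal density is still the density of a subprobability.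
\<close>

lemma nef_law_measurable [measurable]:
  assumes t: "t \<in> nef_pars \<kappa>"
  shows "(\<lambda>c. nef_law \<kappa> c t) \<in> borel \<rightarrow>\<^sub>M subprob_algebra borel"
proof -
  have disc: "(\<lambda>c::real. G (nat \<lfloor>c\<rfloor>)) \<in> borel \<rightarrow>\<^sub>M subprob_algebra borel"
    if "\<And>i. prob_space (G i)" "\<And>i. sets (G i) = sets borel" for G :: "nat \<Rightarrow> real measure"
  proof (rule measurable_compose[where N = "count_space UNIV" and g = G])
    show "(\<lambda>c::real. nat \<lfloor>c\<rfloor>) \<in> borel \<rightarrow>\<^sub>M count_space UNIV"
      by measurable
    show "G \<in> count_space UNIV \<rightarrow>\<^sub>M subprob_algebra borel"
      using that by (auto simp: space_subprob_algebra intro: prob_space_imp_subprob_space)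
  qed
  show ?thesis
  proof (cases \<kappa>)
    case Norm
    have sub: "subprob_space (nef_law Norm c t)" for c
    proof (cases "c = 0")
      case True
      then show ?thesis
        by (intro subprob_spaceI) (auto simp: emeasure_density normal_density_def)
    next
      case False
      have "normal_density (c * t) (sqrt c) = normal_density (c * t) \<bar>sqrt c\<bar>"
        by (simp add: normal_density_def fun_eq_iff)
      then have "nef_law Norm c t = density lborel (\<lambda>y. ennreal (normal_density (c * t) \<bar>sqrt c\<bar> y))"
        by simp
      then show ?thesis using False
        by (simp add: prob_space_imp_subprob_space prob_space_normal_density)
    qed
    show ?thesis unfolding Norm
    proof (rule measurable_subprob_algebra)
      show "subprob_space (nef_law Norm c t)" for c by (rule sub)
      show "sets (nef_law Norm c t) = sets borel" for c by simp
      fix A :: "real set" assume [measurable]: "A \<in> sets borel"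
      have "(\<lambda>c. \<integral>\<^sup>+y. ennreal (normal_density (c * t) (sqrt c) y) * indicator A y \<partial>lborel) \<in> borel_measurable borel"
        unfolding normal_density_def by measurable
      then show "(\<lambda>c. emeasure (nef_law Norm c t) A) \<in> borel_measurable borel"
        by (simp add: emeasure_density)
    qed
  next
    case Poi
    then show ?thesis
      using disc[of "\<lambda>i. nat_law (poisson_pmf (real i * exp t))"] by (simp add: prob_space_nat_law)
  next
    case Bin
    then show ?thesis
      using disc[of "\<lambda>i. nat_law (binomial_pmf i (exp t / (1 + exp t)))"] by (simp add: prob_space_nat_law)
  next
    case NegBin
    then show ?thesis
      using disc[of "\<lambda>i. nat_law (neg_binomial_pmf i (1 - exp t))"] by (simp add: prob_space_nat_law)
  next
    case Gam
    have "prob_space (density lborel (\<lambda>y. ennreal (erlang_density k (- t) y)))" for k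
      by (rule prob_space_erlang_density) (use t Gam in simp)
    then show ?thesis unfolding Gam
      using disc[of "\<lambda>i. density lborel (\<lambda>y. ennreal (erlang_density (i - 1) (- t) y))"] by simp
  qed
qed

lemma nef_shapes_Nats: "\<kappa> \<noteq> Norm \<Longrightarrow> nef_shapes \<kappa> \<subseteq> \<nat>"
  by (cases \<kappa>) auto

lemma Nats_dist_less_1: "x \<in> \<nat> \<Longrightarrow> y \<in> \<nat> \<Longrightarrow> \<bar>x - y\<bar> < (1::real) \<Longrightarrow> x = y"
  by (auto simp: Nats_def)

definition std_Phi :: "real \<Rightarrow> real" where
  "std_Phi x = measure (density lborel (\<lambda>y. ennreal (std_normal_density y))) {..x}"

lemma normal_law_atMost:
  assumes [arith]: "0 < \<sigma>"
  shows "measure (density lborel (\<lambda>y. ennreal (normal_density \<mu> \<sigma> y))) {..y} = std_Phi ((y - \<mu>) / \<sigma>)"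
proof -
  have scale: "\<sigma> * normal_density \<mu> \<sigma> (\<mu> + \<sigma> * z) = std_normal_density z" for z
    by (simp add: normal_density_def real_sqrt_mult power_mult_distrib)
  have ind: "indicator {..y} (\<mu> + \<sigma> * z) = (indicator {..(y - \<mu>) / \<sigma>} z :: ennreal)" for z
    by (simp add: indicator_def pos_le_divide_eq algebra_simps)
  have "emeasure (density lborel (\<lambda>y. ennreal (normal_density \<mu> \<sigma> y))) {..y}
      = (\<integral>\<^sup>+x. ennreal (normal_density \<mu> \<sigma> x) * indicator {..y} x \<partial>lborel)"
    by (subst emeasure_density) auto
  also have "\<dots> = ennreal \<sigma> * (\<integral>\<^sup>+z. ennreal (normal_density \<mu> \<sigma> (\<mu> + \<sigma> * z)) * indicator {..y} (\<mu> + \<sigma> * z) \<partial>lborel)"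
    by (subst nn_integral_real_affine[where c = \<sigma> and t = \<mu>]) auto
  also have "\<dots> = (\<integral>\<^sup>+z. ennreal (std_normal_density z) * indicator {..(y - \<mu>) / \<sigma>} z \<partial>lborel)"
    by (subst nn_integral_cmult[symmetric])
       (auto simp: ind mult.assoc[symmetric] ennreal_mult'[symmetric] scale)
  also have "\<dots> = emeasure (density lborel (\<lambda>y. ennreal (std_normal_density y))) {..(y - \<mu>) / \<sigma>}"
    by (subst emeasure_density) auto
  finally show ?thesis by (simp add: std_Phi_def measure_def)
qed

lemma std_Phi_has_derivative:
  "(std_Phi has_real_derivative std_normal_density x) (at x)"
proof -
  let ?M = "density lborel (\<lambda>y. ennreal (std_normal_density y))"
  interpret prob_space ?M by (rule prob_space_normal_density) simp
  define a b where "a = x - 1" and "b = x + 1"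
  have cont: "continuous_on S std_normal_density" for S
  proof -
    have "continuous_on S (\<lambda>x. 1 / sqrt (2 * pi) * exp (- x\<^sup>2 / 2))"
      by (intro continuous_intros) auto
    then show ?thesis by (simp only: std_normal_density_def[symmetric])
  qed
  have eq: "std_Phi y = std_Phi a + integral {a..y} std_normal_density" if "y \<in> {a..b}" for y
  proof -
    have "emeasure ?M {a<..y} = (\<integral>\<^sup>+z. ennreal (indicator {a<..y} z * std_normal_density z) \<partial>lborel)"
      by (subst emeasure_density) (auto intro!: nn_integral_cong simp: indicator_def)
    also have "\<dots> = ennreal (\<integral>z. indicator {a<..y} z * std_normal_density z \<partial>lborel)"
      by (rule nn_integral_eq_integral)
         (use integrable_mult_indicator[of "{a<..y}" lborel std_normal_density] in auto)
    finally have "measure ?M {a<..y} = (\<integral>z. indicator {a<..y} z * std_normal_density z \<partial>lborel)"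
      by (simp add: measure_def integral_nonneg_AE)
    also have "\<dots> = (\<integral>z. indicator {a..y} z * std_normal_density z \<partial>lborel)"
      using AE_lborel_singleton[of a]
      by (intro integral_cong_AE) (auto elim!: eventually_mono simp: indicator_def)
    also have "\<dots> = (LINT z:{a..y}|lborel. std_normal_density z)"
      by (simp add: set_lebesgue_integral_def)
    also have "\<dots> = integral {a..y} std_normal_density"
      by (rule set_borel_integral_eq_integral) (rule borel_integrable_atLeastAtMost', rule cont)
    finally have "measure ?M {a<..y} = integral {a..y} std_normal_density" .
    moreover have "{..y} = {..a} \<union> {a<..y}" using that by auto
    then have "std_Phi y = std_Phi a + measure ?M {a<..y}"
      unfolding std_Phi_def by (simp, subst finite_measure_Union[symmetric]) auto
    ultimately show ?thesis by simp
  qed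
  have "((\<lambda>y. integral {a..y} std_normal_density) has_real_derivative std_normal_density x) (at x within {a..b})"
    by (rule integral_has_real_derivative[OF cont]) (simp add: a_def b_def)
  from DERIV_add[OF DERIV_const this]
  have "((\<lambda>y. std_Phi a + integral {a..y} std_normal_density) has_real_derivative std_normal_density x) (at x within {a..b})"
    by simp
  then have "(std_Phi has_real_derivative std_normal_density x) (at x within {a..b})"
  proof (rule has_field_derivative_transform_within[where d = 1])
    show "x \<in> {a..b}" by (simp add: a_def b_def)
    fix y assume "y \<in> {a..b}"
    from eq[OF this] show "std_Phi a + integral {a..y} std_normal_density = std_Phi y" by (rule sym)
  qed simp
  then show ?thesis
    by (simp add: at_within_Icc_at a_def b_def)
qed

lemma std_Phi_eq_cdf: "std_Phi = cdf std_normal_distribution"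
  by (rule ext) (simp only: std_Phi_def cdf_def)

lemma std_Phi_at_top: "(std_Phi \<longlongrightarrow> 1) at_top"
  unfolding std_Phi_eq_cdf by (rule real_distribution.cdf_lim_at_top_prob[OF real_dist_normal_dist])

lemma std_Phi_at_bot: "(std_Phi \<longlongrightarrow> 0) at_bot"
  unfolding std_Phi_eq_cdf
  by (rule finite_borel_measure.cdf_lim_at_bot[OF real_distribution.finite_borel_measure_M[OF real_dist_normal_dist]])

text \<open>
  The conditional probabilities are limits over shrinking neighbourhoods of the conditioning point, so
  continuity in \<open>c\<close> decides their value. The integer parameters are isolated points; only
  for the normal law is there something to prove, and half-lines are the only events needed there.
\<close>

lemma nef_law_tendsto:
  assumes c: "c \<in> nef_shapes \<kappa>" and A: "\<kappa> = Norm \<Longrightarrow> \<exists>y. A = {..y}"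
  shows "((\<lambda>c'. measure (nef_law \<kappa> c' t) A) \<longlongrightarrow> measure (nef_law \<kappa> c t) A) (at c within nef_shapes \<kappa>)"
proof (cases "\<kappa> = Norm")
  case False
  \<comment> \<open>Distinct natural numbers are at distance at least 1.\<close>
  have "eventually (\<lambda>c'. c' = c) (at c within nef_shapes \<kappa>)"
    unfolding eventually_at using nef_shapes_Nats[OF False] c
    by (intro exI[of _ 1]) (auto simp: dist_real_def intro: Nats_dist_less_1)
  then show ?thesis by (rule tendsto_eventually[OF eventually_mono]) simp
next
  case True
  then obtain y where y: "A = {..y}" using A by auto
  have c0: "0 < c" using c True by simp
  have "isCont (\<lambda>c'. (y - c' * t) / sqrt c') c"
    using c0 by (intro continuous_intros) auto
  then have "isCont (\<lambda>c'. std_Phi ((y - c' * t) / sqrt c')) c"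
    using isCont_o2[OF _ DERIV_isCont[OF std_Phi_has_derivative]] by blast
  then have "((\<lambda>c'. std_Phi ((y - c' * t) / sqrt c')) \<longlongrightarrow> std_Phi ((y - c * t) / sqrt c)) (at c within nef_shapes \<kappa>)"
    unfolding isCont_def by (rule tendsto_within_subset) simp
  moreover have "eventually (\<lambda>c'. std_Phi ((y - c' * t) / sqrt c') = measure (nef_law \<kappa> c' t) A) (at c within nef_shapes \<kappa>)"
    unfolding eventually_at_topological True y by (intro exI[of _ UNIV]) (simp add: normal_law_atMost)
  ultimately have "((\<lambda>c'. measure (nef_law \<kappa> c' t) A) \<longlongrightarrow> std_Phi ((y - c * t) / sqrt c)) (at c within nef_shapes \<kappa>)"
    by (rule Lim_transform_eventually)
  then show ?thesis using c0 by (simp add: True y normal_law_atMost)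
qed

section \<open>Distribution functions as functions of the natural parameter\<close>

definition poisson_cdf :: "nat \<Rightarrow> real \<Rightarrow> real" where
  "poisson_cdf s r = (\<Sum>i\<le>s. r ^ i / fact i * exp (- r))"

text \<open>
  The terms of the derivative telescope. The gamma laws use the same function, through
  the duality between Poisson counts and gamma waiting times.
\<close>

lemma poisson_cdf_has_derivative:
  "(poisson_cdf s has_real_derivative - (r ^ s / fact s * exp (- r))) (at r)"
proof (induction s)
  case 0
  have "((\<lambda>r. exp (- r)) has_real_derivative - exp (- r)) (at r)"
    by (auto intro!: derivative_eq_intros)
  then show ?case by (simp add: poisson_cdf_def[abs_def])
next
  case (Suc s)
  have 1: "((\<lambda>r::real. r ^ Suc s / fact (Suc s)) has_real_derivative r ^ s / fact s) (at r)"
    using DERIV_cdivide[OF DERIV_pow[of "Suc s" r], of "fact (Suc s)"]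
    by (simp add: divide_simps del: of_nat_Suc)
  have 2: "((\<lambda>r. exp (- r)) has_real_derivative - exp (- r)) (at r)"
    by (auto intro!: derivative_eq_intros)
  have "((\<lambda>r. r ^ Suc s / fact (Suc s) * exp (- r)) has_real_derivative
       (r ^ s / fact s * exp (- r) - r ^ Suc s / fact (Suc s) * exp (- r))) (at r)"
    using DERIV_mult[OF 1 2] by (simp add: algebra_simps del: fact_Suc)
  from DERIV_add[OF Suc.IH this] show ?case
    by (simp add: poisson_cdf_def[abs_def])
qed

lemma poisson_cdf_0: "poisson_cdf s 0 = 1"
proof -
  have "poisson_cdf s 0 = (\<Sum>i\<le>s. if i = 0 then 1 else 0)"
    unfolding poisson_cdf_def by (rule sum.cong) auto
  then show ?thesis by simp
qed

lemma poisson_cdf_at_top: "(poisson_cdf s \<longlongrightarrow> 0) at_top"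
proof -
  have "((\<lambda>r::real. \<Sum>i\<le>s. (r ^ i / exp r) / fact i) \<longlongrightarrow> (\<Sum>i\<le>s. 0 / fact i)) at_top"
    by (intro tendsto_sum tendsto_divide tendsto_power_div_exp_0 tendsto_const) auto
  then show ?thesis
    by (simp add: poisson_cdf_def[abs_def] exp_minus field_simps)
qed

definition binomial_cdf :: "nat \<Rightarrow> nat \<Rightarrow> real \<Rightarrow> real" where
  "binomial_cdf m s p = (\<Sum>i\<le>s. real (m choose i) * p ^ i * (1 - p) ^ (m - i))"

text \<open>
  The terms of the derivative telescope, by \<open>(s + 1) (m choose (s + 1)) = (m - s) (m choose s)\<close>.
\<close>

lemma binomial_cdf_has_derivative:
  assumes "s < m"
  shows "(binomial_cdf m s has_real_derivative
     - (real ((m - s) * (m choose s)) * p ^ s * (1 - p) ^ (m - s - 1))) (at p)"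
  using assms
proof (induction s)
  case 0
  have "((\<lambda>p. (1 - p) ^ m) has_real_derivative - (real m * (1 - p) ^ (m - 1))) (at p)"
    by (auto intro!: derivative_eq_intros)
  then show ?case by (simp add: binomial_cdf_def[abs_def])
next
  case (Suc s)
  have eq: "(Suc s) * (m choose Suc s) = (m - s) * (m choose s)"
    using Suc.prems binomial_absorb_comp[of m s] binomial_absorption[of s m] by simp
  obtain l where l: "m = Suc (Suc (s + l))" using Suc.prems less_iff_Suc_add by auto
  have "((\<lambda>p. real (m choose Suc s) * p ^ Suc s * (1 - p) ^ (m - Suc s)) has_real_derivative
       (real (m choose Suc s) * (real (Suc s) * p ^ s) * (1 - p) ^ (m - s - 1)
         - real (m choose Suc s) * p ^ Suc s * (real (m - Suc s) * (1 - p) ^ (m - Suc s - 1)))) (at p)"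
    by (rule derivative_eq_intros refl | simp)+
  also have "real (m choose Suc s) * (real (Suc s) * p ^ s) = real ((m - s) * (m choose s)) * p ^ s"
    unfolding eq[symmetric] by (simp only: of_nat_mult mult_ac)
  finally have "((\<lambda>p. real (m choose Suc s) * p ^ Suc s * (1 - p) ^ (m - Suc s)) has_real_derivative
       (real ((m - s) * (m choose s)) * p ^ s * (1 - p) ^ (m - s - 1)
         - real ((m - Suc s) * (m choose Suc s)) * p ^ Suc s * (1 - p) ^ (m - Suc s - 1))) (at p)"
    by (simp add: mult_ac)
  from DERIV_add[OF Suc.IH this] Suc.prems show ?case
    by (simp add: binomial_cdf_def[abs_def])
qed

lemma binomial_cdf_0: "binomial_cdf m s 0 = 1"
proof -
  have "binomial_cdf m s 0 = (\<Sum>i\<le>s. if i = 0 then 1 else 0)"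
    unfolding binomial_cdf_def by (rule sum.cong) auto
  then show ?thesis by simp
qed

lemma binomial_cdf_1: "s < m \<Longrightarrow> binomial_cdf m s 1 = 0"
  unfolding binomial_cdf_def by (rule sum.neutral) auto

text \<open>
  What the standing assumption on the observed value \<open>y\<close> of a sum with law \<open>nef_law \<kappa> c t\<close> amounts
  to: \<open>y\<close> lies in the support, below its supremum, and above its infimum if that has no mass.
\<close>

fun nef_admissible :: "nef \<Rightarrow> real \<Rightarrow> real \<Rightarrow> bool" where
  "nef_admissible Poi c y \<longleftrightarrow> y \<in> \<nat>"
| "nef_admissible Bin c y \<longleftrightarrow> y \<in> \<nat> \<and> y < c"
| "nef_admissible NegBin c y \<longleftrightarrow> y \<in> \<nat>"
| "nef_admissible Gam c y \<longleftrightarrow> 0 < y"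
| "nef_admissible Norm c y \<longleftrightarrow> True"

text \<open>
  The fiducial density of \<open>t\<close>, up to a factor that depends on \<open>c\<close> and \<open>y\<close> only.
\<close>

fun nef_fid :: "nef \<Rightarrow> real \<Rightarrow> real \<Rightarrow> real \<Rightarrow> real" where
  "nef_fid Poi c y t = exp (t * (y + 1) - c * exp t)"
| "nef_fid Bin c y t = exp (t * (y + 1) - (c + 1) * ln (1 + exp t))"
| "nef_fid NegBin c y t = exp (t * (y + 1) + (c - 1) * ln (1 - exp t))"
| "nef_fid Gam c y t = exp (t * y) * (- t) powr (c - 1)"
| "nef_fid Norm c y t = exp (t * y - c * t\<^sup>2 / 2)"

text \<open>
  If a distribution function decreases from 1 to 0 along the parameter, then minus its derivative
  is a probability density in the parameter, by the fundamental theorem of calculus.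
\<close>

lemma nn_integral_minus_derivative:
  fixes F f :: "real \<Rightarrow> real" and b :: ereal
  assumes b: "b \<noteq> - \<infinity>"
    and D: "\<And>t. ereal t < b \<Longrightarrow> (F has_real_derivative - f t) (at t)"
    and C: "\<And>t. ereal t < b \<Longrightarrow> isCont f t"
    and pos: "\<And>t. 0 \<le> f t"
    and bot: "(F \<longlongrightarrow> 1) at_bot"
    and top: "((F \<circ> real_of_ereal) \<longlongrightarrow> 0) (at_left b)"
  shows "(\<integral>\<^sup>+t. ennreal (f t) * indicator (einterval (- \<infinity>) b) t \<partial>lborel) = 1"
proof -
  have lt: "- \<infinity> < b" using b by (simp add: less_ereal.simps(2) ereal_infty_less(2))
  note FTC = interval_integral_FTC_nonneg[OF lt, of "\<lambda>t. - F t" f "- 1" 0]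
  have D': "DERIV (\<lambda>t. - F t) t :> f t" if "ereal t < b" for t
    using DERIV_minus[OF D[OF that]] by simp
  have l1: "(((\<lambda>t. - F t) \<circ> real_of_ereal) \<longlongrightarrow> - 1) (at_right (- \<infinity>))"
    using tendsto_minus[OF bot] by (simp add: ereal_tendsto_simps1)
  have l2: "(((\<lambda>t. - F t) \<circ> real_of_ereal) \<longlongrightarrow> 0) (at_left b)"
    using tendsto_minus[OF top] by (simp add: comp_def)
  have int: "set_integrable lborel (einterval (- \<infinity>) b) f"
    by (rule FTC(1)) (use D' C pos l1 l2 in auto)
  have "(LBINT t=-\<infinity>..b. f t) = 0 - (- 1)"
    by (rule FTC(2)) (use D' C pos l1 l2 in auto)
  then have "(LBINT t:einterval (- \<infinity>) b. f t) = 1"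
    using lt by (simp add: interval_lebesgue_integral_def less_imp_le)
  then have "(\<integral>t. indicator (einterval (- \<infinity>) b) t * f t \<partial>lborel) = 1"
    by (simp add: set_lebesgue_integral_def)
  moreover have "(\<integral>\<^sup>+t. ennreal (f t) * indicator (einterval (- \<infinity>) b) t \<partial>lborel)
      = (\<integral>\<^sup>+t. ennreal (indicator (einterval (- \<infinity>) b) t * f t) \<partial>lborel)"
    by (intro nn_integral_cong) (simp add: indicator_def)
  moreover have "\<dots> = ennreal (\<integral>t. indicator (einterval (- \<infinity>) b) t * f t \<partial>lborel)"
    using int pos by (intro nn_integral_eq_integral) (auto simp: set_integrable_def)
  ultimately show ?thesis by simp
qed

lemma measure_pmf_atMost: "measure (measure_pmf p) {..s} = (\<Sum>i\<le>(s::nat). pmf p i)"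
  by (rule measure_measure_pmf_finite) simp

lemma Poi_law_atMost:
  assumes "1 \<le> m"
  shows "measure (nef_law Poi (real m) t) {..real s} = poisson_cdf s (real m * exp t)"
  using assms by (simp add: measure_nat_law_atMost measure_pmf_atMost poisson_cdf_def)

lemma Bin_law_atMost:
  "measure (nef_law Bin (real m) t) {..real s} = binomial_cdf m s (exp t / (1 + exp t))"
proof -
  have "0 \<le> exp t / (1 + exp t)" "exp t / (1 + exp t) \<le> 1"
    by (simp_all add: field_simps add_pos_pos add_nonneg_nonneg)
  then show ?thesis by (simp add: measure_nat_law_atMost measure_pmf_atMost binomial_cdf_def)
qed

text \<open>
  At most \<open>s\<close> failures before the \<open>m\<close>-th success means at most \<open>s\<close> failures in \<open>m + s\<close> trials.
\<close>

lemma NegBin_law_atMost: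
  assumes "t < 0"
  shows "measure (nef_law NegBin (real m) t) {..real s} = binomial_cdf (m + s) s (exp t)"
  using assms
  by (simp add: measure_nat_law_atMost prob_neg_binomial_pmf_atMost)
     (simp add: measure_pmf_atMost binomial_cdf_def)

lemma Gam_law_atMost:
  assumes "t < 0" "0 < y"
  shows "measure (nef_law Gam (real (Suc k)) t) {..y} = 1 - poisson_cdf k (- t * y)"
  using assms emeasure_erlang_density[of "- t" k y] erlang_CDF_nonneg[of "- t" k y]
  by (simp add: measure_def erlang_CDF_def poisson_cdf_def del: of_nat_Suc)

lemma Norm_law_atMost:
  assumes "0 < c"
  shows "measure (nef_law Norm c t) {..y} = std_Phi ((y - c * t) / sqrt c)"
  using assms by (simp add: normal_law_atMost)

text \<open>
  Each case is the chain rule applied to a closed form of the distribution function: with the Poisson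
  intensity \<open>m e\<^sup>t\<close>, the success probability \<open>e\<^sup>t / (1 + e\<^sup>t)\<close>, the failure probability \<open>e\<^sup>t\<close>, the scaled
  waiting time \<open>- t y\<close>, and the standardized value \<open>(y - c t) / sqrt c\<close>.
  The admissibility of \<open>y\<close> makes the constant positive.
\<close>

lemma nef_law_atMost_has_derivative:
  assumes "c \<in> nef_shapes \<kappa>" "nef_admissible \<kappa> c y"
  shows "\<exists>C>0. \<forall>t\<in>nef_pars \<kappa>.
    ((\<lambda>t. measure (nef_law \<kappa> c t) {..y}) has_real_derivative - (C * nef_fid \<kappa> c y t)) (at t)"
proof (cases \<kappa>)
  case Poi
  then obtain m s where [simp]: "c = real m" "y = real s" and m: "1 \<le> m"
    using assms by (auto simp: Nats_def)
  define C where "C = real m ^ Suc s / fact s"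
  have "((\<lambda>t. poisson_cdf s (real m * exp t)) has_real_derivative - (C * nef_fid Poi c y t)) (at t)" for t
  proof -
    have "((\<lambda>t. poisson_cdf s (real m * exp t)) has_real_derivative
       - ((real m * exp t) ^ s / fact s * exp (- (real m * exp t))) * (real m * exp t)) (at t)"
      by (rule DERIV_chain2[OF poisson_cdf_has_derivative]) (auto intro!: derivative_eq_intros)
    also have "- ((real m * exp t) ^ s / fact s * exp (- (real m * exp t))) * (real m * exp t) = - (C * nef_fid Poi c y t)"
      by (simp add: C_def power_mult_distrib exp_of_nat2_mult[symmetric] exp_add exp_diff exp_minus field_simps)
    finally show ?thesis .
  qed
  moreover have "0 < C" using m by (simp add: C_def)
  ultimately show ?thesis using Poi by (auto simp: Poi_law_atMost[OF m] simp del: nef_law.simps)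
next
  case Bin
  then obtain m s where [simp]: "c = real m" "y = real s" and s: "s < m"
    using assms by (auto simp: Nats_def)
  define C where "C = real ((m - s) * (m choose s))"
  have "((\<lambda>t. binomial_cdf m s (exp t / (1 + exp t))) has_real_derivative - (C * nef_fid Bin c y t)) (at t)" for t
  proof -
    have pos: "0 < 1 + exp t" by (simp add: add_pos_pos)
    obtain l where l: "m = Suc (s + l)" using s less_iff_Suc_add by auto
    have d: "((\<lambda>t. exp t / (1 + exp t)) has_real_derivative exp t / (1 + exp t)\<^sup>2) (at t)"
      using pos by (auto intro!: derivative_eq_intros simp: power2_eq_square field_simps)
    have q: "1 - exp t / (1 + exp t) = 1 / (1 + exp t)"
      using pos by (simp add: field_simps)
    have "exp ((real m + 1) * ln (1 + exp t)) = (1 + exp t) ^ Suc m"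
      using pos by (simp add: exp_of_nat_mult[of "Suc m", simplified] add.commute)
    then have fid: "nef_fid Bin c y t = exp t ^ Suc s / (1 + exp t) ^ Suc m"
      by (simp add: exp_diff exp_of_nat2_mult[of t "Suc s", simplified] add.commute)
    have "((\<lambda>t. binomial_cdf m s (exp t / (1 + exp t))) has_real_derivative
       - (C * (exp t / (1 + exp t)) ^ s * (1 - exp t / (1 + exp t)) ^ (m - s - 1)) * (exp t / (1 + exp t)\<^sup>2)) (at t)"
      unfolding C_def by (rule DERIV_chain2[OF binomial_cdf_has_derivative[OF s] d])
    also have "- (C * (exp t / (1 + exp t)) ^ s * (1 - exp t / (1 + exp t)) ^ (m - s - 1)) * (exp t / (1 + exp t)\<^sup>2)
        = - (C * nef_fid Bin c y t)"
      unfolding q fid using pos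
      by (simp add: l power_divide power_add power2_eq_square field_simps)
    finally show ?thesis .
  qed
  moreover have "0 < C" using s by (simp add: C_def)
  ultimately show ?thesis using Bin by (auto simp: Bin_law_atMost simp del: nef_law.simps)
next
  case NegBin
  then obtain m s where [simp]: "c = real m" "y = real s" and m: "1 \<le> m"
    using assms by (auto simp: Nats_def)
  define C where "C = real (m * ((m + s) choose s))"
  have "((\<lambda>t. binomial_cdf (m + s) s (exp t)) has_real_derivative - (C * nef_fid NegBin c y t)) (at t)"
    if t: "t < 0" for t
  proof -
    have pos: "0 < 1 - exp t" using t by simp
    have "exp ((real m - 1) * ln (1 - exp t)) = (1 - exp t) ^ (m - 1)"
      using pos m exp_of_nat_mult[of "m - 1" "ln (1 - exp t)"] by (simp add: of_nat_diff)
    then have fid: "nef_fid NegBin c y t = exp t ^ Suc s * (1 - exp t) ^ (m - 1)"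
      by (simp add: exp_add exp_of_nat2_mult[of t "Suc s", simplified] add.commute)
    have s: "s < m + s" using m by simp
    have "((\<lambda>t. binomial_cdf (m + s) s (exp t)) has_real_derivative
       - (C * exp t ^ s * (1 - exp t) ^ (m - 1)) * exp t) (at t)"
      using DERIV_chain2[OF binomial_cdf_has_derivative[OF s] DERIV_exp] by (simp add: C_def)
    then show ?thesis unfolding fid by (simp add: mult_ac)
  qed
  moreover have "0 < C" using m by (simp add: C_def)
  ultimately have *: "\<exists>C>0. \<forall>t\<in>nef_pars \<kappa>. ((\<lambda>t. binomial_cdf (m + s) s (exp t)) has_real_derivative - (C * nef_fid NegBin c y t)) (at t)"
    using NegBin by auto
  have "((\<lambda>t. measure (nef_law \<kappa> c t) {..y}) has_real_derivative D) (at t)"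
    if t: "t < 0" and D: "((\<lambda>t. binomial_cdf (m + s) s (exp t)) has_real_derivative D) (at t)" for t D
    by (rule has_field_derivative_transform_within_open[OF D, where S = "{..<0}"])
       (use t NegBin in \<open>auto simp: NegBin_law_atMost simp del: nef_law.simps\<close>)
  then show ?thesis using * NegBin by (fastforce simp del: nef_law.simps)
next
  case Gam
  then obtain m where "c = real m" and m: "1 \<le> m" and y: "0 < y"
    using assms by (auto simp: Nats_def)
  moreover obtain k where "m = Suc k" using m by (cases m) auto
  ultimately have [simp]: "c = real (Suc k)" by simp
  define C where "C = y ^ Suc k / fact k"
  have "((\<lambda>t. 1 - poisson_cdf k (- t * y)) has_real_derivative - (C * nef_fid Gam c y t)) (at t)"
    if t: "t < 0" for t
  proof -
    have fid: "nef_fid Gam c y t = exp (t * y) * (- t) ^ k"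
      using t by (simp add: powr_realpow)
    have "((\<lambda>t. poisson_cdf k (- t * y)) has_real_derivative
        - ((- t * y) ^ k / fact k * exp (- (- t * y))) * (- y)) (at t)"
      by (rule DERIV_chain2[OF poisson_cdf_has_derivative]) (auto intro!: derivative_eq_intros)
    from DERIV_diff[OF DERIV_const[of 1] this]
    have "((\<lambda>t. 1 - poisson_cdf k (- t * y)) has_real_derivative
        0 - - ((- t * y) ^ k / fact k * exp (- (- t * y))) * (- y)) (at t)" .
    also have "0 - - ((- t * y) ^ k / fact k * exp (- (- t * y))) * (- y) = - (C * nef_fid Gam c y t)"
      unfolding fid C_def power_mult_distrib by simp
    finally show ?thesis .
  qed
  moreover have "0 < C" using y by (simp add: C_def)
  ultimately have *: "\<exists>C>0. \<forall>t\<in>nef_pars \<kappa>. ((\<lambda>t. 1 - poisson_cdf k (- t * y)) has_real_derivative - (C * nef_fid Gam c y t)) (at t)"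
    using Gam by auto
  have "((\<lambda>t. measure (nef_law \<kappa> c t) {..y}) has_real_derivative D) (at t)"
    if t: "t < 0" and D: "((\<lambda>t. 1 - poisson_cdf k (- t * y)) has_real_derivative D) (at t)" for t D
    by (rule has_field_derivative_transform_within_open[OF D, where S = "{..<0}"])
       (use t y Gam Gam_law_atMost in \<open>auto simp del: nef_law.simps of_nat_Suc\<close>)
  then show ?thesis using * Gam by (fastforce simp del: nef_law.simps of_nat_Suc)
next
  case Norm
  then have c: "0 < c" using assms by simp
  define C where "C = sqrt c / sqrt (2 * pi) * exp (- y\<^sup>2 / (2 * c))"
  have "((\<lambda>t. std_Phi ((y - c * t) / sqrt c)) has_real_derivative - (C * nef_fid Norm c y t)) (at t)" for t
  proof -
    have "((\<lambda>t. (y - c * t) / sqrt c) has_real_derivative - c / sqrt c) (at t)"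
      by (rule DERIV_cdivide) (auto intro!: derivative_eq_intros)
    then have d: "((\<lambda>t. (y - c * t) / sqrt c) has_real_derivative - sqrt c) (at t)"
      using c by (simp add: real_div_sqrt)
    have "- ((y - c * t) / sqrt c)\<^sup>2 / 2 = - y\<^sup>2 / (2 * c) + (t * y - c * t\<^sup>2 / 2)"
      using c by (simp add: power_divide power2_diff power_mult_distrib) (simp add: field_simps power2_eq_square)
    then have "std_normal_density ((y - c * t) / sqrt c) * - sqrt c = - (C * nef_fid Norm c y t)"
      by (simp only: std_normal_density_def C_def exp_add nef_fid.simps) (simp add: field_simps)
    then show ?thesis
      using DERIV_chain2[OF std_Phi_has_derivative d] by simp
  qed
  moreover have "0 < C" using c by (simp add: C_def)
  ultimately show ?thesis using Norm by (auto simp: Norm_law_atMost[OF c] simp del: nef_law.simps)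
qed

text \<open>
  At the lower end of the parameter range the mass moves to the lower end of the support, which is
  not above \<open>y\<close>.
\<close>

lemma nef_law_atMost_at_bot:
  assumes "c \<in> nef_shapes \<kappa>" "nef_admissible \<kappa> c y"
  shows "((\<lambda>t. measure (nef_law \<kappa> c t) {..y}) \<longlongrightarrow> 1) at_bot"
proof (cases \<kappa>)
  case Poi
  then obtain m s where [simp]: "c = real m" "y = real s" and m: "1 \<le> m"
    using assms by (auto simp: Nats_def)
  have "((\<lambda>t. poisson_cdf s (real m * exp t)) \<longlongrightarrow> poisson_cdf s (real m * 0)) at_bot"
    by (intro isCont_tendsto_compose[OF DERIV_isCont[OF poisson_cdf_has_derivative]]
          tendsto_mult tendsto_const exp_at_bot)
  then show ?thesis using Poi by (simp add: Poi_law_atMost[OF m] poisson_cdf_0 del: nef_law.simps)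
next
  case Bin
  then obtain m s where [simp]: "c = real m" "y = real s" and s: "s < m"
    using assms by (auto simp: Nats_def)
  have "((\<lambda>t. exp t / (1 + exp t)) \<longlongrightarrow> 0 / (1 + 0 :: real)) at_bot"
    by (intro tendsto_intros exp_at_bot) auto
  then have "((\<lambda>t. binomial_cdf m s (exp t / (1 + exp t))) \<longlongrightarrow> binomial_cdf m s 0) at_bot"
    by (intro isCont_tendsto_compose[OF DERIV_isCont[OF binomial_cdf_has_derivative[OF s]]]) simp
  then show ?thesis using Bin by (simp add: Bin_law_atMost binomial_cdf_0 del: nef_law.simps)
next
  case NegBin
  then obtain m s where [simp]: "c = real m" "y = real s" and m: "1 \<le> m"
    using assms by (auto simp: Nats_def)
  have s: "s < m + s" using m by simp
  have "((\<lambda>t. binomial_cdf (m + s) s (exp t)) \<longlongrightarrow> binomial_cdf (m + s) s 0) at_bot"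
    by (intro isCont_tendsto_compose[OF DERIV_isCont[OF binomial_cdf_has_derivative[OF s]]] exp_at_bot)
  moreover have "eventually (\<lambda>t. binomial_cdf (m + s) s (exp t) = measure (nef_law \<kappa> c t) {..y}) at_bot"
    using NegBin
    by (auto simp: NegBin_law_atMost eventually_at_bot_dense simp del: nef_law.simps intro!: exI[of _ 0])
  ultimately show ?thesis by (simp add: binomial_cdf_0 Lim_transform_eventually)
next
  case Gam
  then obtain m where "c = real m" and m: "1 \<le> m" and y: "0 < y"
    using assms by (auto simp: Nats_def)
  moreover obtain k where "m = Suc k" using m by (cases m) auto
  ultimately have [simp]: "c = real (Suc k)" by simp
  have "filterlim (\<lambda>t. - t * y) at_top at_bot"
    using y by (intro filterlim_at_top_mult_tendsto_pos[OF tendsto_const] filterlim_uminus_at_top_at_bot)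
  then have "((\<lambda>t. 1 - poisson_cdf k (- t * y)) \<longlongrightarrow> 1 - 0) at_bot"
    by (intro tendsto_diff tendsto_const filterlim_compose[OF poisson_cdf_at_top])
  moreover have "eventually (\<lambda>t. 1 - poisson_cdf k (- t * y) = measure (nef_law \<kappa> c t) {..y}) at_bot"
    using Gam y Gam_law_atMost[of _ y k]
    by (auto simp: eventually_at_bot_dense simp del: nef_law.simps of_nat_Suc intro!: exI[of _ 0])
  ultimately show ?thesis by (simp add: Lim_transform_eventually)
next
  case Norm
  then have c: "0 < c" using assms by simp
  have "filterlim (\<lambda>t. - t * sqrt c) at_top at_bot"
    using c by (intro filterlim_at_top_mult_tendsto_pos[OF tendsto_const] filterlim_uminus_at_top_at_bot) auto
  then have "filterlim (\<lambda>t. y / sqrt c + - t * sqrt c) at_top at_bot"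
    by (rule filterlim_tendsto_add_at_top[OF tendsto_const])
  moreover have "y / sqrt c + - t * sqrt c = (y - c * t) / sqrt c" for t
    using c by (simp add: field_simps)
  ultimately have "((\<lambda>t. std_Phi ((y - c * t) / sqrt c)) \<longlongrightarrow> 1) at_bot"
    using filterlim_compose[OF std_Phi_at_top] by simp
  then show ?thesis using Norm by (simp add: Norm_law_atMost[OF c] del: nef_law.simps)
qed

text \<open>
  At the upper end of the parameter range the mass escapes to the upper end of the support, which
  is above \<open>y\<close>.
\<close>

lemma nef_law_atMost_at_top:
  assumes "c \<in> nef_shapes \<kappa>" "nef_admissible \<kappa> c y"
  shows "((\<lambda>t. measure (nef_law \<kappa> c t) {..y}) \<longlongrightarrow> 0) (if nef_pars \<kappa> = UNIV then at_top else at_left 0)"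
proof (cases \<kappa>)
  case Poi
  then obtain m s where [simp]: "c = real m" "y = real s" and m: "1 \<le> m"
    using assms by (auto simp: Nats_def)
  have "filterlim (\<lambda>t. real m * exp t) at_top at_top"
    using m by (intro filterlim_tendsto_pos_mult_at_top[OF tendsto_const] exp_at_top) auto
  then have "((\<lambda>t. poisson_cdf s (real m * exp t)) \<longlongrightarrow> 0) at_top"
    by (rule filterlim_compose[OF poisson_cdf_at_top])
  then show ?thesis using Poi by (simp add: Poi_law_atMost[OF m] del: nef_law.simps)
next
  case Bin
  then obtain m s where [simp]: "c = real m" "y = real s" and s: "s < m"
    using assms by (auto simp: Nats_def)
  have "((\<lambda>t. 1 - inverse (1 + exp t)) \<longlongrightarrow> (1 - 0 :: real)) at_top"
    by (intro tendsto_diff tendsto_const tendsto_inverse_0_at_top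
          filterlim_tendsto_add_at_top[OF tendsto_const exp_at_top])
  moreover have "1 - inverse (1 + exp t) = exp t / (1 + exp t)" for t :: real
    using add_pos_pos[of 1 "exp t"] by (simp add: field_simps)
  ultimately have "((\<lambda>t. exp t / (1 + exp t)) \<longlongrightarrow> (1 :: real)) at_top"
    by simp
  then have "((\<lambda>t. binomial_cdf m s (exp t / (1 + exp t))) \<longlongrightarrow> binomial_cdf m s 1) at_top"
    by (rule isCont_tendsto_compose[OF DERIV_isCont[OF binomial_cdf_has_derivative[OF s]]])
  then show ?thesis using Bin by (simp add: Bin_law_atMost binomial_cdf_1 s del: nef_law.simps)
next
  case NegBin
  then obtain m s where [simp]: "c = real m" "y = real s" and m: "1 \<le> m"
    using assms by (auto simp: Nats_def)
  have s: "s < m + s" using m by simp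
  have "((\<lambda>t. binomial_cdf (m + s) s (exp t)) \<longlongrightarrow> binomial_cdf (m + s) s (exp 0)) (at_left 0)"
    by (intro isCont_tendsto_compose[OF DERIV_isCont[OF binomial_cdf_has_derivative[OF s]]] tendsto_intros)
  moreover have "eventually (\<lambda>t. binomial_cdf (m + s) s (exp t) = measure (nef_law \<kappa> c t) {..y}) (at_left 0)"
    using NegBin
    by (auto simp: NegBin_law_atMost eventually_at_filter simp del: nef_law.simps)
  ultimately have "((\<lambda>t. measure (nef_law \<kappa> c t) {..y}) \<longlongrightarrow> 0) (at_left 0)"
    using binomial_cdf_1[OF s] by (simp only: exp_zero Lim_transform_eventually)
  moreover have "nef_pars \<kappa> \<noteq> UNIV" using NegBin by (auto simp: set_eq_iff intro: exI[of _ 0])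
  ultimately show ?thesis by simp
next
  case Gam
  then obtain m where "c = real m" and m: "1 \<le> m" and y: "0 < y"
    using assms by (auto simp: Nats_def)
  moreover obtain k where "m = Suc k" using m by (cases m) auto
  ultimately have [simp]: "c = real (Suc k)" by simp
  have "((\<lambda>t. 1 - poisson_cdf k (- t * y)) \<longlongrightarrow> 1 - poisson_cdf k (- 0 * y)) (at_left 0)"
    by (intro tendsto_intros isCont_tendsto_compose[OF DERIV_isCont[OF poisson_cdf_has_derivative]])
  moreover have "eventually (\<lambda>t. 1 - poisson_cdf k (- t * y) = measure (nef_law \<kappa> c t) {..y}) (at_left 0)"
    using Gam y Gam_law_atMost[of _ y k]
    by (auto simp: eventually_at_filter simp del: nef_law.simps of_nat_Suc)
  ultimately have "((\<lambda>t. measure (nef_law \<kappa> c t) {..y}) \<longlongrightarrow> 0) (at_left 0)"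
    by (simp add: poisson_cdf_0 Lim_transform_eventually)
  moreover have "nef_pars \<kappa> \<noteq> UNIV" using Gam by (auto simp: set_eq_iff intro: exI[of _ 0])
  ultimately show ?thesis by simp
next
  case Norm
  then have c: "0 < c" using assms by simp
  have "filterlim (\<lambda>t. t * sqrt c) at_top at_top"
    using c by (intro filterlim_at_top_mult_tendsto_pos[OF tendsto_const] filterlim_ident) auto
  then have "filterlim (\<lambda>t. - y / sqrt c + t * sqrt c) at_top at_top"
    by (rule filterlim_tendsto_add_at_top[OF tendsto_const])
  then have "filterlim (\<lambda>t. - (- y / sqrt c + t * sqrt c)) at_bot at_top"
    by (simp only: filterlim_uminus_at_bot minus_minus)
  moreover have "- (- y / sqrt c + t * sqrt c) = (y - c * t) / sqrt c" for t
    using c by (simp add: field_simps)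
  ultimately have "((\<lambda>t. std_Phi ((y - c * t) / sqrt c)) \<longlongrightarrow> 0) at_top"
    using filterlim_compose[OF std_Phi_at_bot] by simp
  then show ?thesis using Norm by (simp add: Norm_law_atMost[OF c] del: nef_law.simps)
qed

lemma nef_fid_nonneg: "0 \<le> nef_fid \<kappa> c y t"
  by (cases \<kappa>) auto

lemma nef_fid_isCont:
  assumes "t \<in> nef_pars \<kappa>"
  shows "isCont (nef_fid \<kappa> c y) t"
proof -
  have pos: "1 + exp t \<noteq> 0" by (smt (verit) exp_gt_zero)
  have "isCont (\<lambda>t. nef_fid \<kappa> c y t) t"
    using assms pos by (cases \<kappa>) (auto intro!: continuous_intros)
  then show ?thesis .
qed

lemma open_nef_pars: "open (nef_pars \<kappa>)"
  by (cases \<kappa>) auto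

lemma nef_fid_borel_measurable [measurable]: "nef_fid \<kappa> c y \<in> borel_measurable borel"
proof -
  have "(\<lambda>t. nef_fid \<kappa> c y t) \<in> borel_measurable borel"
    by (cases \<kappa>) simp_all
  then show ?thesis .
qed

lemma nef_fiducial:
  assumes "c \<in> nef_shapes \<kappa>" "nef_admissible \<kappa> c y"
  shows "\<exists>C>0. (\<forall>t\<in>nef_pars \<kappa>.
       ((\<lambda>t. measure (nef_law \<kappa> c t) {..y}) has_real_derivative - (C * nef_fid \<kappa> c y t)) (at t)) \<and>
     (\<integral>\<^sup>+t. ennreal (C * nef_fid \<kappa> c y t) * indicator (nef_pars \<kappa>) t \<partial>lborel) = 1"
proof -
  let ?F = "\<lambda>t. measure (nef_law \<kappa> c t) {..y}"
  obtain C where C: "0 < C"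
    and D: "\<And>t. t \<in> nef_pars \<kappa> \<Longrightarrow> (?F has_real_derivative - (C * nef_fid \<kappa> c y t)) (at t)"
    using nef_law_atMost_has_derivative[OF assms] by blast
  define b :: ereal where "b = (if nef_pars \<kappa> = UNIV then \<infinity> else 0)"
  have pars: "nef_pars \<kappa> = einterval (- \<infinity>) b"
    by (cases \<kappa>) (auto simp: b_def einterval_def zero_ereal_def set_eq_iff)
  have top: "((?F \<circ> real_of_ereal) \<longlongrightarrow> 0) (at_left b)"
    using nef_law_atMost_at_top[OF assms]
    by (auto simp: b_def zero_ereal_def ereal_tendsto_simps1 simp del: nef_law.simps split: if_splits)
  have "(\<integral>\<^sup>+t. ennreal (C * nef_fid \<kappa> c y t) * indicator (einterval (- \<infinity>) b) t \<partial>lborel) = 1"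
  proof (rule nn_integral_minus_derivative)
    show "b \<noteq> - \<infinity>" by (simp add: b_def)
    fix t
    show "0 \<le> C * nef_fid \<kappa> c y t" using C nef_fid_nonneg by (simp add: less_imp_le)
    assume "ereal t < b"
    then have t: "t \<in> nef_pars \<kappa>" by (simp add: pars einterval_def)
    then show "(?F has_real_derivative - (C * nef_fid \<kappa> c y t)) (at t)" by (rule D)
    show "isCont (\<lambda>t. C * nef_fid \<kappa> c y t) t"
      using nef_fid_isCont[OF t] by (intro continuous_intros)
  qed (use nef_law_atMost_at_bot[OF assms] top in auto)
  with C D show ?thesis by (auto simp: pars)
qed

section \<open>Sums of independent copies of a disintegrated variable\<close>

text \<open>
  Let \<open>Y\<close> have, given the vector \<open>V\<close>, the law \<open>K c\<close>, where \<open>c\<close> is a function of the observation,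
  and let \<open>K\<close> be a convolution semigroup on \<open>T\<close>. Then for i.i.d.\ copies the sum of
  the \<open>Y\<close> has, given the sum of the \<open>V\<close>, the law \<open>K\<close> at the sum of the \<open>c\<close>. The proof adds one
  copy at a time: with the new copy fixed, the old sum may be replaced by a draw from its kernel, and with
  the old sums fixed, so may the new \<open>Y\<close>; two independent draws from \<open>K a\<close> and \<open>K b\<close> sum up to one from
  \<open>K (a + b)\<close>. The identity is stated for product events, a class that is invariant under the translations
  this argument needs.
\<close>

lemma iid_sum_disintegration:
  fixes P :: "'a measure" and K :: "real \<Rightarrow> real measure"
    and Y c :: "'a \<Rightarrow> real" and V :: "'j \<Rightarrow> 'a \<Rightarrow> real" and I :: "'i set"
  assumes P: "prob_space P"
    and J: "finite J"
    and Y[measurable]: "Y \<in> borel_measurable P" and c[measurable]: "c \<in> borel_measurable P"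
    and V[measurable]: "\<And>j. j \<in> J \<Longrightarrow> V j \<in> borel_measurable P"
    and K[measurable]: "K \<in> borel \<rightarrow>\<^sub>M subprob_algebra borel"
    and T_add: "\<And>a b. a \<in> T \<Longrightarrow> b \<in> T \<Longrightarrow> a + b \<in> T"
    and K_conv: "\<And>a b. a \<in> T \<Longrightarrow> b \<in> T \<Longrightarrow> (K a \<star> K b) = K (a + b)"
    and c_T: "AE x in P. c x \<in> T"
    and one: "\<And>A B. A \<in> sets borel \<Longrightarrow> (\<And>j. j \<in> J \<Longrightarrow> B j \<in> sets borel) \<Longrightarrow>
      (\<integral>\<^sup>+x. indicator A (Y x) * (\<Prod>j\<in>J. indicator (B j) (V j x)) \<partial>P)
      = (\<integral>\<^sup>+x. emeasure (K (c x)) A * (\<Prod>j\<in>J. indicator (B j) (V j x)) \<partial>P)"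
    and I: "finite I" "I \<noteq> {}"
  shows "\<And>A B. A \<in> sets borel \<Longrightarrow> (\<And>j. j \<in> J \<Longrightarrow> B j \<in> sets borel) \<Longrightarrow>
      (\<integral>\<^sup>+\<omega>. indicator A (\<Sum>i\<in>I. Y (\<omega> i)) * (\<Prod>j\<in>J. indicator (B j) (\<Sum>i\<in>I. V j (\<omega> i))) \<partial>(\<Pi>\<^sub>M i\<in>I. P))
      = (\<integral>\<^sup>+\<omega>. emeasure (K (\<Sum>i\<in>I. c (\<omega> i))) A * (\<Prod>j\<in>J. indicator (B j) (\<Sum>i\<in>I. V j (\<omega> i))) \<partial>(\<Pi>\<^sub>M i\<in>I. P))"
    and "AE \<omega> in (\<Pi>\<^sub>M i\<in>I. P). (\<Sum>i\<in>I. c (\<omega> i)) \<in> T"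
proof -
  interpret P: prob_space P by (rule P)
  interpret PP: product_prob_space "\<lambda>_::'i. P" by standard
  have AE_c: "AE \<omega> in (\<Pi>\<^sub>M i\<in>I. P). (\<Sum>i\<in>I. c (\<omega> i)) \<in> T" if "finite I" "I \<noteq> {}" for I :: "'i set"
  proof -
    have "AE \<omega> in (\<Pi>\<^sub>M i\<in>I. P). \<forall>i\<in>I. c (\<omega> i) \<in> T"
      using that c_T by (intro AE_finite_allI AE_PiM_component) (auto intro: P)
    moreover have "(\<Sum>i\<in>I. f i) \<in> T" if "\<forall>i\<in>I. f i \<in> T" for f
      using \<open>finite I\<close> \<open>I \<noteq> {}\<close> that by (induction rule: finite_ne_induct) (auto intro: T_add)
    ultimately show ?thesis by (auto elim!: eventually_mono)
  qed
  then show "AE \<omega> in (\<Pi>\<^sub>M i\<in>I. P). (\<Sum>i\<in>I. c (\<omega> i)) \<in> T" using I by blast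
  have Kfin: "finite_measure (K a)" "sets (K a) = sets borel" for a
    using measurable_space[OF K, of a] by (auto simp: space_subprob_algebra subprob_space_def)
  fix A :: "real set" and B :: "'j \<Rightarrow> real set"
  assume AB: "A \<in> sets borel" "\<And>j. j \<in> J \<Longrightarrow> B j \<in> sets borel"
  show "(\<integral>\<^sup>+\<omega>. indicator A (\<Sum>i\<in>I. Y (\<omega> i)) * (\<Prod>j\<in>J. indicator (B j) (\<Sum>i\<in>I. V j (\<omega> i))) \<partial>(\<Pi>\<^sub>M i\<in>I. P))
      = (\<integral>\<^sup>+\<omega>. emeasure (K (\<Sum>i\<in>I. c (\<omega> i))) A * (\<Prod>j\<in>J. indicator (B j) (\<Sum>i\<in>I. V j (\<omega> i))) \<partial>(\<Pi>\<^sub>M i\<in>I. P))"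
    using I AB
  proof (induction I arbitrary: A B rule: finite_ne_induct)
    case (singleton i)
    note singleton(1)[measurable]
    have [measurable]: "\<And>j. j \<in> J \<Longrightarrow> B j \<in> sets borel" by (rule singleton(2))
    have "(\<integral>\<^sup>+\<omega>. indicator A (Y (\<omega> i)) * (\<Prod>j\<in>J. indicator (B j) (V j (\<omega> i))) \<partial>(\<Pi>\<^sub>M i\<in>{i}. P))
        = (\<integral>\<^sup>+x. indicator A (Y x) * (\<Prod>j\<in>J. indicator (B j) (V j x)) \<partial>P)"
      by (rule PP.product_nn_integral_singleton) measurable
    also have "\<dots> = (\<integral>\<^sup>+x. emeasure (K (c x)) A * (\<Prod>j\<in>J. indicator (B j) (V j x)) \<partial>P)"
      by (rule one[OF singleton])
    also have "\<dots> = (\<integral>\<^sup>+\<omega>. emeasure (K (c (\<omega> i))) A * (\<Prod>j\<in>J. indicator (B j) (V j (\<omega> i))) \<partial>(\<Pi>\<^sub>M i\<in>{i}. P))"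
      by (rule PP.product_nn_integral_singleton[symmetric]) measurable
    finally show ?case by simp
  next
    case (insert i I)
    note insert.prems(1)[measurable]
    have [measurable]: "\<And>j. j \<in> J \<Longrightarrow> B j \<in> sets borel" by (rule insert.prems(2))
    let ?M = "\<Pi>\<^sub>M i\<in>I. P"
    interpret M: prob_space ?M by (rule prob_space_PiM) (rule P)
    interpret PM: pair_sigma_finite P ?M ..
    define SY Sc where "SY = (\<lambda>\<omega>. \<Sum>i\<in>I. Y (\<omega> i))" and "Sc = (\<lambda>\<omega>. \<Sum>i\<in>I. c (\<omega> i))"
    define SV where "SV = (\<lambda>j \<omega>. \<Sum>i\<in>I. V j (\<omega> i))"
    have [measurable]: "SY \<in> borel_measurable ?M" "Sc \<in> borel_measurable ?M"
      unfolding SY_def Sc_def by measurable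
    have [measurable]: "SV j \<in> borel_measurable ?M" if [measurable]: "j \<in> J" for j
      unfolding SV_def using that by measurable
    define W :: "'a \<Rightarrow> ('i \<Rightarrow> 'a) \<Rightarrow> ennreal" where "W = (\<lambda>x \<omega>. \<Prod>j\<in>J. indicator (B j) (SV j \<omega> + V j x))"
    have [measurable]: "(\<lambda>(x, \<omega>). W x \<omega>) \<in> borel_measurable (P \<Otimes>\<^sub>M ?M)"
      unfolding W_def by measurable
    have [measurable]: "W x \<in> borel_measurable ?M" if "x \<in> space P" for x
      unfolding W_def using that by measurable
    have shift: "{a. b + a \<in> A} \<in> sets borel" for b by measurable
    have shift2: "{a. a + b \<in> A} \<in> sets borel" for b by measurable
    have shiftB: "{a. a + b \<in> B j} \<in> sets borel" "{a. b + a \<in> B j} \<in> sets borel" if "j \<in> J" for b j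
      using that by measurable
    have upd: "(\<Sum>k\<in>insert i I. f ((fun_upd \<omega> i x) k)) = (\<Sum>k\<in>I. f (\<omega> k)) + f x" for f :: "'a \<Rightarrow> real" and \<omega> x
    proof -
      have "(\<Sum>k\<in>I. f ((fun_upd \<omega> i x) k)) = (\<Sum>k\<in>I. f (\<omega> k))"
        using insert.hyps by (intro sum.cong) auto
      then show ?thesis using insert.hyps by simp
    qed
    have indA: "indicator {a. b + a \<in> S} y = (indicator S (b + y) :: ennreal)"
      "indicator {a. a + b \<in> S} y = (indicator S (y + b) :: ennreal)" for b y :: real and S
      by (simp_all add: indicator_def)
    \<comment> \<open>The kernel replaces the new summand; the old sums act as translations of the events.\<close>
    have in_P: "(\<integral>\<^sup>+x. indicator A (SY \<omega> + Y x) * W x \<omega> \<partial>P)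
        = (\<integral>\<^sup>+x. emeasure (K (c x)) {a. SY \<omega> + a \<in> A} * W x \<omega> \<partial>P)" for \<omega>
      using one[of "{a. SY \<omega> + a \<in> A}" "\<lambda>j. {a. SV j \<omega> + a \<in> B j}"] shift shiftB(2)
      by (simp add: indA W_def)
    \<comment> \<open>The induction hypothesis, for the events translated by the new copy.\<close>
    have in_M: "(\<integral>\<^sup>+\<omega>. indicator A (SY \<omega> + z) * W x \<omega> \<partial>?M)
        = (\<integral>\<^sup>+\<omega>. emeasure (K (Sc \<omega>)) {a. a + z \<in> A} * W x \<omega> \<partial>?M)" for x z
      using insert.IH[of "{a. a + z \<in> A}" "\<lambda>j. {a. a + V j x \<in> B j}"] shift[of z] shiftB(1)
      by (simp add: indA W_def SY_def Sc_def SV_def add.commute[of _ z])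
    have emK: "emeasure (K a) S = (\<integral>\<^sup>+z. indicator S z \<partial>K a)" if "S \<in> sets borel" for a S
      using that Kfin(2)[of a] by simp
    have fub: "(\<integral>\<^sup>+\<omega>. \<integral>\<^sup>+z. g z \<omega> \<partial>K a \<partial>?M) = (\<integral>\<^sup>+z. \<integral>\<^sup>+\<omega>. g z \<omega> \<partial>?M \<partial>K a)"
      if g: "case_prod g \<in> borel_measurable (borel \<Otimes>\<^sub>M ?M)" for g a
    proof -
      interpret Ka: finite_measure "K a" by (rule Kfin)
      interpret pair_sigma_finite "K a" ?M ..
      show ?thesis
        by (rule Fubini') (use g in \<open>simp cong: measurable_cong_sets add: sets_pair_measure_cong[OF Kfin(2) refl]\<close>)
    qed
    have AE_Sc: "AE \<omega> in ?M. Sc \<omega> \<in> T"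
      using AE_c[OF insert.hyps(1,2)] by (simp add: Sc_def)
    have m0[measurable]: "(\<lambda>p. emeasure (K (fst p)) {a. a + snd p \<in> A}) \<in> borel_measurable (borel \<Otimes>\<^sub>M borel)"
    proof -
      have "(\<lambda>p. \<integral>\<^sup>+y. indicator A (y + snd p) \<partial>K (fst p)) \<in> borel_measurable (borel \<Otimes>\<^sub>M borel)"
        by (rule nn_integral_measurable_subprob_algebra2[where N = borel]) measurable
      then show ?thesis by (simp add: emK[OF shift2] indA)
    qed
    have "(\<lambda>p. (\<integral>\<^sup>+z. indicator A (SY (snd p) + z) \<partial>K (c (fst p))) * W (fst p) (snd p)) \<in> borel_measurable (P \<Otimes>\<^sub>M ?M)"
      by (intro borel_measurable_times_ennreal nn_integral_measurable_subprob_algebra2[where N = borel]) measurable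
    then have m1: "(\<lambda>(x, \<omega>). (\<integral>\<^sup>+z. indicator A (SY \<omega> + z) \<partial>K (c x)) * W x \<omega>) \<in> borel_measurable (P \<Otimes>\<^sub>M ?M)"
      by (simp add: case_prod_beta)
    have "(\<lambda>p. (\<integral>\<^sup>+z. emeasure (K (Sc (snd p))) {a. a + z \<in> A} \<partial>K (c (fst p))) * W (fst p) (snd p)) \<in> borel_measurable (P \<Otimes>\<^sub>M ?M)"
    proof (intro borel_measurable_times_ennreal nn_integral_measurable_subprob_algebra2[where N = borel])
      show "(\<lambda>(p, z). emeasure (K (Sc (snd p))) {a. a + z \<in> A}) \<in> borel_measurable ((P \<Otimes>\<^sub>M ?M) \<Otimes>\<^sub>M borel)"
        using measurable_compose[OF measurable_Pair[of "\<lambda>p. Sc (snd (fst p))" "(P \<Otimes>\<^sub>M ?M) \<Otimes>\<^sub>M borel" borel snd borel] m0]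
        by (simp add: case_prod_beta)
    qed measurable
    then have m2: "(\<lambda>(x, \<omega>). (\<integral>\<^sup>+z. emeasure (K (Sc \<omega>)) {a. a + z \<in> A} \<partial>K (c x)) * W x \<omega>) \<in> borel_measurable (P \<Otimes>\<^sub>M ?M)"
      by (simp add: case_prod_beta)
    have m3: "(\<lambda>(z, \<omega>). indicator A (SY \<omega> + z) * W x \<omega>) \<in> borel_measurable (borel \<Otimes>\<^sub>M ?M)" if "x \<in> space P" for x
      using that by measurable
    have m4: "(\<lambda>(z, \<omega>). emeasure (K (Sc \<omega>)) {a. a + z \<in> A} * W x \<omega>) \<in> borel_measurable (borel \<Otimes>\<^sub>M ?M)" if "x \<in> space P" for x
    proof -
      have "(\<lambda>p. emeasure (K (Sc (snd p))) {a. a + fst p \<in> A}) \<in> borel_measurable (borel \<Otimes>\<^sub>M ?M)"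
        using measurable_compose[OF measurable_Pair[of "\<lambda>p. Sc (snd p)" "borel \<Otimes>\<^sub>M ?M" borel fst borel] m0]
        by simp
      then show ?thesis using that unfolding case_prod_beta by measurable
    qed
    have conv: "emeasure (K a \<star> K b) A = (\<integral>\<^sup>+z. emeasure (K b) {y. y + z \<in> A} \<partial>K a)" for a b
      using Kfin sets_eq_imp_space_eq[OF Kfin(2)] insert.prems(1)
      by (intro convolution_emeasure) auto
    have "(\<integral>\<^sup>+\<omega>. indicator A (\<Sum>i\<in>insert i I. Y (\<omega> i)) * (\<Prod>j\<in>J. indicator (B j) (\<Sum>i\<in>insert i I. V j (\<omega> i))) \<partial>(\<Pi>\<^sub>M i\<in>insert i I. P))
      = (\<integral>\<^sup>+\<omega>. \<integral>\<^sup>+x. indicator A (SY \<omega> + Y x) * W x \<omega> \<partial>P \<partial>?M)"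
      by (subst PP.product_nn_integral_insert)
         (use insert.hyps in \<open>auto simp only: upd SY_def SV_def W_def, measurable\<close>)
    also have "\<dots> = (\<integral>\<^sup>+\<omega>. \<integral>\<^sup>+x. (\<integral>\<^sup>+z. indicator A (SY \<omega> + z) \<partial>K (c x)) * W x \<omega> \<partial>P \<partial>?M)"
      by (simp add: in_P emK[OF shift] indA)
    also have "\<dots> = (\<integral>\<^sup>+x. \<integral>\<^sup>+\<omega>. (\<integral>\<^sup>+z. indicator A (SY \<omega> + z) \<partial>K (c x)) * W x \<omega> \<partial>?M \<partial>P)"
      by (rule PM.Fubini'[OF m1])
    also have "\<dots> = (\<integral>\<^sup>+x. \<integral>\<^sup>+\<omega>. (\<integral>\<^sup>+z. indicator A (SY \<omega> + z) * W x \<omega> \<partial>K (c x)) \<partial>?M \<partial>P)"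
      by (intro nn_integral_cong nn_integral_multc[symmetric])
         (simp add: measurable_cong_sets[OF Kfin(2) refl])
    also have "\<dots> = (\<integral>\<^sup>+x. \<integral>\<^sup>+z. (\<integral>\<^sup>+\<omega>. indicator A (SY \<omega> + z) * W x \<omega> \<partial>?M) \<partial>K (c x) \<partial>P)"
      by (intro nn_integral_cong fub m3)
    also have "\<dots> = (\<integral>\<^sup>+x. \<integral>\<^sup>+z. (\<integral>\<^sup>+\<omega>. emeasure (K (Sc \<omega>)) {a. a + z \<in> A} * W x \<omega> \<partial>?M) \<partial>K (c x) \<partial>P)"
      by (simp add: in_M)
    also have "\<dots> = (\<integral>\<^sup>+x. \<integral>\<^sup>+\<omega>. (\<integral>\<^sup>+z. emeasure (K (Sc \<omega>)) {a. a + z \<in> A} * W x \<omega> \<partial>K (c x)) \<partial>?M \<partial>P)"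
      by (intro nn_integral_cong fub[symmetric] m4)
    also have "\<dots> = (\<integral>\<^sup>+x. \<integral>\<^sup>+\<omega>. (\<integral>\<^sup>+z. emeasure (K (Sc \<omega>)) {a. a + z \<in> A} \<partial>K (c x)) * W x \<omega> \<partial>?M \<partial>P)"
    proof (intro nn_integral_cong nn_integral_multc)
      fix x \<omega>
      have "(\<lambda>z. emeasure (K (Sc \<omega>)) {a. a + z \<in> A}) \<in> borel_measurable borel"
        using measurable_compose[OF measurable_Pair1'[of "Sc \<omega>" borel borel] m0] by simp
      then show "(\<lambda>z. emeasure (K (Sc \<omega>)) {a. a + z \<in> A}) \<in> borel_measurable (K (c x))"
        by (simp add: measurable_cong_sets[OF Kfin(2) refl])
    qed
    also have "\<dots> = (\<integral>\<^sup>+\<omega>. \<integral>\<^sup>+x. (\<integral>\<^sup>+z. emeasure (K (Sc \<omega>)) {a. a + z \<in> A} \<partial>K (c x)) * W x \<omega> \<partial>P \<partial>?M)"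
      by (rule PM.Fubini'[OF m2, symmetric])
    also have "\<dots> = (\<integral>\<^sup>+\<omega>. \<integral>\<^sup>+x. emeasure (K (c x) \<star> K (Sc \<omega>)) A * W x \<omega> \<partial>P \<partial>?M)"
      by (simp add: conv)
    also have "\<dots> = (\<integral>\<^sup>+\<omega>. \<integral>\<^sup>+x. emeasure (K (Sc \<omega> + c x)) A * W x \<omega> \<partial>P \<partial>?M)"
    proof (rule nn_integral_cong_AE)
      show "AE \<omega> in ?M. (\<integral>\<^sup>+x. emeasure (K (c x) \<star> K (Sc \<omega>)) A * W x \<omega> \<partial>P)
          = (\<integral>\<^sup>+x. emeasure (K (Sc \<omega> + c x)) A * W x \<omega> \<partial>P)"
        using AE_Sc
      proof eventually_elim
        case (elim \<omega>)
        show ?case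
          by (rule nn_integral_cong_AE, use c_T in eventually_elim) (simp add: K_conv elim add.commute)
      qed
    qed
    also have "\<dots> = (\<integral>\<^sup>+\<omega>. emeasure (K (\<Sum>i\<in>insert i I. c (\<omega> i))) A * (\<Prod>j\<in>J. indicator (B j) (\<Sum>i\<in>insert i I. V j (\<omega> i))) \<partial>(\<Pi>\<^sub>M i\<in>insert i I. P))"
      by (subst PP.product_nn_integral_insert)
         (use insert.hyps in \<open>auto simp only: upd Sc_def SV_def W_def, measurable\<close>)
    finally show ?case .
  qed
qed

section \<open>The law of one observation\<close>

text \<open>
  In every family, given the preceding components, the \<open>k\<close>-th component of one observation has the law
  \<open>nef_law (kind F k) (shape F 1 k x) (\<phi> k)\<close>, and the same holds for the sums over a sample of size
  \<open>n\<close> with \<open>shape F n k\<close> evaluated at the sums. This is possible since \<open>shape\<close> is affine in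
  the components and additive: see \<open>shape_sum\<close>.
\<close>

fun kind :: "family \<Rightarrow> nat \<Rightarrow> nef" where
  "kind (Poisson_Normal m \<sigma>) k = (if k \<le> m then Poi else Norm)"
| "kind (Multinomial N) k = Bin"
| "kind (Neg_Multinomial R) k = NegBin"
| "kind (NM_Gamma_Normal m R) k = (if k \<le> m then NegBin else if k = m + 1 then Gam else Norm)"

fun shape :: "family \<Rightarrow> nat \<Rightarrow> nat \<Rightarrow> (nat \<Rightarrow> real) \<Rightarrow> real" where
  "shape (Poisson_Normal m \<sigma>) n k x = (if k \<le> m then real n else real n * \<sigma>\<^sup>2)"
| "shape (Multinomial N) n k x = real n * real N - prefix_sum x k"
| "shape (Neg_Multinomial R) n k x = real n * real R + prefix_sum x k"
| "shape (NM_Gamma_Normal m R) n k x =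
     (if k \<le> m + 1 then real n * real R + prefix_sum x k else x (m + 1))"

lemma par_range_eq_nef_pars: "par_range F k = nef_pars (kind F k)"
  by (cases F) auto

lemma sets_ref_measure [simp, measurable_cong]: "sets (ref_measure F k) = sets borel"
  by (cases F) (auto simp: count_nat_def)

lemma sigma_finite_count_nat: "sigma_finite_measure count_nat"
proof
  have "emeasure count_nat {x} \<noteq> \<infinity>" for x
  proof -
    have "finite {i. real i = x}"
      by (rule finite_subset[of _ "{nat \<lfloor>x\<rfloor>}"]) auto
    then show ?thesis
      unfolding count_nat_def by (subst emeasure_distr) (auto simp: vimage_def)
  qed
  moreover have Nats: "(\<nat> :: real set) \<in> sets borel"
    by (rule sets.countable) (auto simp: Nats_def)
  then have "emeasure count_nat (- \<nat>) = 0" "- \<nat> \<in> sets count_nat"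
    unfolding count_nat_def by (subst emeasure_distr, auto simp: vimage_def)
  ultimately show "\<exists>A. countable A \<and> A \<subseteq> sets count_nat \<and> \<Union>A = space count_nat \<and> (\<forall>a\<in>A. emeasure count_nat a \<noteq> \<infinity>)"
    by (intro exI[of _ "insert (- \<nat>) ((\<lambda>i. {real i}) ` UNIV)"]) (auto simp: count_nat_def Nats_def)
qed

lemma sigma_finite_ref_measure: "sigma_finite_measure (ref_measure F k)"
  using sigma_finite_count_nat sigma_finite_lborel by (cases F) auto

lemma product_sigma_finite_ref_measure: "product_sigma_finite (ref_measure F)"
  by (rule product_sigma_finite.intro) (rule sigma_finite_ref_measure)

lemma sets_PiM_ref [measurable_cong]: "sets (PiM I (ref_measure F)) = sets (PiM I (\<lambda>_. borel))"
  by (rule sets_PiM_cong) simp_all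

lemma space_PiM_ref: "space (PiM I (ref_measure F)) = space (PiM I (\<lambda>_. borel :: real measure))"
  by (rule sets_eq_imp_space_eq) (rule sets_PiM_ref)

lemma sets_obs_law [measurable_cong]: "sets (obs_law d F \<phi>) = sets (PiM {1..d} (\<lambda>_. borel))"
  by (simp add: obs_law_def sets_PiM_ref)

lemma space_obs_law: "space (obs_law d F \<phi>) = space (PiM {1..d} (\<lambda>_. borel :: real measure))"
  by (rule sets_eq_imp_space_eq) (rule sets_obs_law)

lemma prefix_sum_upd [simp]: "k \<le> i \<Longrightarrow> prefix_sum (x(i := y)) k = prefix_sum x k"
  by (auto simp: prefix_sum_def intro!: sum.cong)

lemma prefix_sum_Suc: "1 \<le> k \<Longrightarrow> prefix_sum x (Suc k) = prefix_sum x k + x k"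
  by (simp add: prefix_sum_def)

text \<open>
  Each factor of the joint density looks at its own and at earlier components only, so the
  components can be integrated out from the last one.
\<close>

lemma cond_density_upd: "k < i \<Longrightarrow> cond_density F k t (x(i := y)) = cond_density F k t x"
  by (cases F) auto

lemma cond_density_nonneg: "t \<in> par_range F k \<Longrightarrow> 0 \<le> cond_density F k t x"
  by (cases F) auto

lemma shape_sum:
  assumes "finite I"
  shows "(\<Sum>i\<in>I. shape F 1 k (x i)) = shape F (card I) k (\<lambda>j. \<Sum>i\<in>I. x i j)"
proof -
  have "prefix_sum (\<lambda>j. \<Sum>i\<in>I. x i j) k = (\<Sum>i\<in>I. prefix_sum (x i) k)"
    unfolding prefix_sum_def by (rule sum.swap)
  then show ?thesis by (cases F) (auto simp: sum.distrib sum_subtractf)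
qed

lemma prefix_sum_measurable [measurable]:
  assumes "k \<le> Suc d"
  shows "(\<lambda>x. prefix_sum x k) \<in> borel_measurable (PiM {1..d} (\<lambda>_. borel))"
  unfolding prefix_sum_def using assms
  by (intro borel_measurable_sum measurable_component_singleton) auto

lemma shape_measurable [measurable]:
  assumes "1 \<le> k" "k \<le> Suc d"
  shows "shape F n k \<in> borel_measurable (PiM {1..d} (\<lambda>_. borel))"
proof -
  have "(\<lambda>x. shape F n k x) \<in> borel_measurable (PiM {1..d} (\<lambda>_. borel))"
    using assms prefix_sum_measurable[OF assms(2)]
  proof (cases F)
    case (NM_Gamma_Normal m R)
    then show ?thesis
      using assms prefix_sum_measurable[OF assms(2)]
      by (cases "k \<le> m + 1") (auto intro!: measurable_component_singleton)
  qed auto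
  then show ?thesis .
qed

lemma cond_density_measurable [measurable]:
  assumes "k \<in> {1..d}"
  shows "cond_density F k t \<in> borel_measurable (PiM {1..d} (\<lambda>_. borel))"
proof -
  let ?M = "PiM {1..d} (\<lambda>_. borel :: real measure)"
  have x: "(\<lambda>x. x j) \<in> borel_measurable ?M" if "j \<in> {1..d}" for j
    using that by (rule measurable_component_singleton)
  note assms[measurable]
  have xk: "(\<lambda>x. x k) \<in> borel_measurable ?M" by (rule x[OF assms])
  have p[measurable]: "(\<lambda>x. prefix_sum x k) \<in> borel_measurable ?M"
    using assms by (intro prefix_sum_measurable) auto
  have pmf: "(\<lambda>x. pmf (G (r x)) (nat \<lfloor>x k\<rfloor>)) \<in> borel_measurable ?M"
    if "r \<in> ?M \<rightarrow>\<^sub>M count_space UNIV" for G :: "nat \<Rightarrow> nat pmf" and r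
  proof (rule measurable_compose_countable[where f = "\<lambda>i x. pmf (G i) (nat \<lfloor>x k\<rfloor>)", OF _ that])
    show "(\<lambda>x. pmf (G i) (nat \<lfloor>x k\<rfloor>)) \<in> borel_measurable ?M" for i
    proof -
      have "(\<lambda>y::real. pmf (G i) (nat \<lfloor>y\<rfloor>)) \<in> borel_measurable borel" by measurable
      from measurable_compose[OF xk this] show ?thesis .
    qed
  qed
  have erl: "(\<lambda>x. erlang_density (r x) l (x k)) \<in> borel_measurable ?M"
    if "r \<in> ?M \<rightarrow>\<^sub>M count_space UNIV" for l :: real and r
  proof (rule measurable_compose_countable[where f = "\<lambda>i x. erlang_density i l (x k)", OF _ that])
    show "(\<lambda>x. erlang_density i l (x k)) \<in> borel_measurable ?M" for i
    proof -
      have "(\<lambda>y::real. erlang_density i l y) \<in> borel_measurable borel" by measurable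
      from measurable_compose[OF xk this] show ?thesis .
    qed
  qed
  have "(\<lambda>x. cond_density F k t x) \<in> borel_measurable ?M"
  proof (cases F)
    case (Poisson_Normal m \<sigma>)
    have "(\<lambda>x. pmf (poisson_pmf (exp t)) (nat \<lfloor>x k\<rfloor>)) \<in> borel_measurable ?M"
      by (rule pmf[of "\<lambda>_. 0" "\<lambda>_. poisson_pmf (exp t)"]) simp
    moreover have "(\<lambda>x. normal_density (\<sigma>\<^sup>2 * t) \<sigma> (x k)) \<in> borel_measurable ?M"
      by (rule measurable_compose[OF xk borel_measurable_normal_density])
    ultimately show ?thesis using Poisson_Normal by (cases "k \<le> m") (simp_all del: pmf_poisson)
  next
    case (Multinomial N)
    have "(\<lambda>x. nat \<lfloor>real N - prefix_sum x k\<rfloor>) \<in> ?M \<rightarrow>\<^sub>M count_space UNIV" by measurable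
    from pmf[OF this, of "\<lambda>r. binomial_pmf r (exp t / (1 + exp t))"] show ?thesis
      using Multinomial by simp
  next
    case (Neg_Multinomial R)
    have "(\<lambda>x. R + nat \<lfloor>prefix_sum x k\<rfloor>) \<in> ?M \<rightarrow>\<^sub>M count_space UNIV" by measurable
    from pmf[OF this, of "\<lambda>r. neg_binomial_pmf r (1 - exp t)"] show ?thesis
      using Neg_Multinomial by simp
  next
    case (NM_Gamma_Normal m R)
    have 1: "(\<lambda>x. R + nat \<lfloor>prefix_sum x k\<rfloor>) \<in> ?M \<rightarrow>\<^sub>M count_space UNIV" by measurable
    have 2: "(\<lambda>x. R + nat \<lfloor>prefix_sum x k\<rfloor> - 1) \<in> ?M \<rightarrow>\<^sub>M count_space UNIV" by measurable
    have 3: "(\<lambda>x. normal_density (t * x (m + 1)) (sqrt (x (m + 1))) (x k)) \<in> borel_measurable ?M"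
      if "\<not> k \<le> m"
    proof -
      have [measurable]: "(\<lambda>x. x (m + 1)) \<in> borel_measurable ?M"
        using that assms by (intro x) auto
      show ?thesis unfolding normal_density_def by measurable
    qed
    show ?thesis
      using pmf[OF 1, of "\<lambda>r. neg_binomial_pmf r (1 - exp t)"] erl[OF 2, of "- t"] 3 NM_Gamma_Normal
      by (cases "k \<le> m"; cases "k = m + 1") simp_all
  qed
  then show ?thesis .
qed

text \<open>
  The hypothesis on the prefix sum is there because the density truncates negative prefix sums to zero.
\<close>

lemma nn_integral_cond_density:
  assumes F: "valid_family D F" and t: "t \<in> par_range F k" and k: "1 \<le> k"
    and p: "kind F k = NegBin \<or> kind F k = Gam \<Longrightarrow> 0 \<le> prefix_sum x k"
    and [measurable]: "f \<in> borel_measurable borel"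
  shows "(\<integral>\<^sup>+y. ennreal (cond_density F k t (x(k := y))) * f y \<partial>ref_measure F k)
       = (\<integral>\<^sup>+y. f y \<partial>nef_law (kind F k) (shape F 1 k x) t)"
proof -
  have nat: "(\<integral>\<^sup>+y. ennreal (pmf q (nat \<lfloor>y\<rfloor>)) * f y \<partial>count_nat) = (\<integral>\<^sup>+y. f y \<partial>nat_law q)" for q
    unfolding nat_law_eq_density by (subst nn_integral_density) (auto simp: count_nat_def)
  have leb: "(\<integral>\<^sup>+y. ennreal (g y) * f y \<partial>lborel) = (\<integral>\<^sup>+y. f y \<partial>density lborel (\<lambda>y. ennreal (g y)))"
    if [measurable]: "g \<in> borel_measurable borel" for g
    by (subst nn_integral_density) auto
  have floor: "nat (int R + \<lfloor>prefix_sum x k\<rfloor>) = R + nat \<lfloor>prefix_sum x k\<rfloor>" if "0 \<le> prefix_sum x k" for R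
    using that by (simp add: nat_add_distrib)
  show ?thesis
    using F p k
    by (cases F) (auto simp: nat leb floor mult.commute[of t] simp del: pmf_poisson)
qed

lemma (in product_sigma_finite) AE_PiM_all:
  assumes I: "finite I" and Q: "\<And>i. i \<in> I \<Longrightarrow> AE y in M i. Q i y"
  shows "AE x in PiM I M. \<forall>i\<in>I. Q i (x i)"
proof (rule AE_finite_allI[OF I])
  fix i assume i: "i \<in> I"
  obtain N where N: "N \<in> null_sets (M i)" "{y \<in> space (M i). \<not> Q i y} \<subseteq> N"
    using Q[OF i] by (auto elim!: AE_E simp: null_sets_def)
  define A where "A j = (if j = i then N else space (M j))" for j
  have "emeasure (PiM I M) (Pi\<^sub>E I A) = (\<Prod>j\<in>I. emeasure (M j) (A j))"
    using N by (intro emeasure_PiM I) (auto simp: A_def null_sets_def)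
  also have "\<dots> = 0"
    using I i N by (intro prod_zero bexI[of _ i]) (auto simp: A_def null_sets_def)
  finally have "Pi\<^sub>E I A \<in> null_sets (PiM I M)"
    using I N by (auto intro!: null_setsI sets_PiM_I_finite simp: A_def null_sets_def)
  then show "AE x in PiM I M. Q i (x i)"
  proof (rule AE_I')
    show "{x \<in> space (PiM I M). \<not> Q i (x i)} \<subseteq> Pi\<^sub>E I A"
      using N(2) i by (auto simp: space_PiM A_def PiE_iff Pi_iff extensional_def)
  qed
qed

lemma ref_measure_kind:
  "ref_measure F j = (if kind F j \<in> {Poi, Bin, NegBin} then count_nat else lborel)"
  by (cases F) auto

text \<open>
  Almost every observation has regular components only. For these the truncations in the densities
  have no effect, and the gamma component, which is the variance of the later normal ones, does not vanish.
\<close>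

definition regular_point :: "family \<Rightarrow> nat \<Rightarrow> real \<Rightarrow> bool" where
  "regular_point F j y \<longleftrightarrow> (if kind F j \<in> {Poi, Bin, NegBin} then y \<in> \<nat> else y \<noteq> 0)"

lemma AE_regular_point: "AE y in ref_measure F j. regular_point F j y"
proof -
  have Nats: "(\<nat> :: real set) \<in> sets borel"
    by (rule sets.countable) (auto simp: Nats_def)
  have "AE y in count_nat. y \<in> \<nat>"
    unfolding count_nat_def using Nats by (subst AE_distr_iff) auto
  moreover have "AE y in lborel. y \<noteq> (0::real)" by (rule AE_lborel_singleton)
  ultimately show ?thesis
    unfolding ref_measure_kind regular_point_def by simp
qed

lemma joint_density_measurable:
  "(\<lambda>x. ennreal (\<Prod>k=1..d. cond_density F k (\<phi> k) x)) \<in> borel_measurable (PiM {1..d} (ref_measure F))"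
  unfolding measurable_cong_sets[OF sets_PiM_ref refl]
  by (intro measurable_compose[OF _ measurable_ennreal] borel_measurable_prod cond_density_measurable)

lemma AE_regular_points:
  "AE x in PiM {1..d} (ref_measure F). \<forall>j\<in>{1..d}. regular_point F j (x j)"
proof -
  interpret product_sigma_finite "ref_measure F" by (rule product_sigma_finite_ref_measure)
  show ?thesis by (rule AE_PiM_all) (simp_all add: AE_regular_point)
qed

lemma prefix_sum_Nats:
  assumes "\<And>j. j \<in> {1..<k} \<Longrightarrow> x j \<in> \<nat>"
  shows "prefix_sum x k \<in> \<nat>"
proof -
  have "(\<Sum>j\<in>J. x j) \<in> \<nat>" if "finite J" "\<forall>j\<in>J. x j \<in> \<nat>" for J
    using that by (induction rule: finite_induct) auto
  then show ?thesis using assms by (simp add: prefix_sum_def)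
qed

lemma regular_prefix_Nats:
  assumes "kind F k \<in> {Bin, NegBin, Gam}" "\<forall>j\<in>{1..<k}. regular_point F j (x j)"
  shows "prefix_sum x k \<in> \<nat>"
proof (rule prefix_sum_Nats)
  fix j assume j: "j \<in> {1..<k}"
  then have "kind F j \<in> {Poi, Bin, NegBin}" using assms(1) by (cases F) (auto split: if_splits)
  then show "x j \<in> \<nat>" using assms(2) j by (auto simp: regular_point_def)
qed

text \<open>
  A positive joint density keeps the convolution parameter in its range: a multinomial observation
  cannot exceed the number of trials, and the gamma component is positive.
\<close>

lemma shape_in_nef_shapes:
  assumes F: "valid_family D F" and k: "1 \<le> k"
    and reg: "\<forall>j\<in>{1..<k}. regular_point F j (x j)"
    and pos: "\<forall>j\<in>{1..<k}. cond_density F j (\<phi> j) x \<noteq> 0"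
  shows "shape F 1 k x \<in> nef_shapes (kind F k)"
proof (cases F)
  case (Poisson_Normal m \<sigma>)
  then show ?thesis using F by auto
next
  case (Multinomial N)
  have x: "x j \<in> \<nat>" if "j \<in> {1..<k}" for j
    using reg that Multinomial by (auto simp: regular_point_def)
  have "prefix_sum x i \<in> \<nat> \<and> prefix_sum x i \<le> real N" if "1 \<le> i" "i \<le> k" for i
    using that
  proof (induction i rule: dec_induct)
    case base
    then show ?case by (simp add: prefix_sum_def)
  next
    case (step i)
    then have i: "i \<in> {1..<k}" by simp
    \<comment> \<open>A count above the remaining number of trials would have mass zero.\<close>
    obtain a b where a: "prefix_sum x i = real a" "a \<le> N" and b: "x i = real b"
      using step x[OF i] by (auto simp: Nats_def)
    have "0 \<le> exp (\<phi> i) / (1 + exp (\<phi> i))" "exp (\<phi> i) / (1 + exp (\<phi> i)) \<le> 1"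
      by (simp_all add: field_simps add_pos_pos add_nonneg_nonneg)
    moreover have "pmf (binomial_pmf (N - a) (exp (\<phi> i) / (1 + exp (\<phi> i)))) b \<noteq> 0"
    proof -
      have "nat \<lfloor>real N - prefix_sum x i\<rfloor> = N - a"
        using a by (simp flip: of_nat_diff)
      then show ?thesis using bspec[OF pos i] Multinomial b by simp
    qed
    ultimately have "b \<le> N - a"
      by (metis binomial_eq_0 mult_zero_left not_le of_nat_0 pmf_binomial)
    then have "a + b \<le> N" using a by simp
    moreover have "prefix_sum x (Suc i) = real (a + b)"
      using step a b by (simp add: prefix_sum_Suc)
    ultimately show ?case by simp
  qed
  from this[of k] k obtain a where "prefix_sum x k = real a" "a \<le> N" by (auto simp: Nats_def)
  then have "real N - prefix_sum x k = real (N - a)" by simp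
  then show ?thesis using Multinomial by (simp del: of_nat_diff)
next
  case (Neg_Multinomial R)
  then obtain a where "prefix_sum x k = real a"
    using regular_prefix_Nats[OF _ reg] by (auto simp: Nats_def)
  then show ?thesis using Neg_Multinomial F by auto
next
  case (NM_Gamma_Normal m R)
  show ?thesis
  proof (cases "k \<le> m + 1")
    case True
    then obtain a where "prefix_sum x k = real a"
      using NM_Gamma_Normal regular_prefix_Nats[OF _ reg] by (cases "k = m + 1") (auto simp: Nats_def)
    then show ?thesis using True NM_Gamma_Normal F by auto
  next
    case False
    then have "m + 1 \<in> {1..<k}" by simp
    then have "x (m + 1) \<noteq> 0" "cond_density F (m + 1) (\<phi> (m + 1)) x \<noteq> 0"
      using bspec[OF reg, of "m + 1"] bspec[OF pos, of "m + 1"] NM_Gamma_Normal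
      by (simp_all add: regular_point_def)
    then have "0 < x (m + 1)"
      using NM_Gamma_Normal by (auto simp: erlang_density_def split: if_splits)
    then show ?thesis using False NM_Gamma_Normal by simp
  qed
qed

lemma AE_shape_in_nef_shapes:
  assumes F: "valid_family D F"
  shows "AE x in obs_law d F \<phi>. \<forall>k\<in>{1..Suc d}. shape F 1 k x \<in> nef_shapes (kind F k)"
proof -
  show ?thesis
    unfolding obs_law_def
  proof (subst AE_density[OF joint_density_measurable])
    show "AE x in PiM {1..d} (ref_measure F). 0 < ennreal (\<Prod>k=1..d. cond_density F k (\<phi> k) x) \<longrightarrow>
       (\<forall>k\<in>{1..Suc d}. shape F 1 k x \<in> nef_shapes (kind F k))"
      using AE_regular_points
    proof eventually_elim
      case (elim x)
      show ?case
      proof (intro impI ballI)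
        fix k assume "0 < ennreal (\<Prod>k=1..d. cond_density F k (\<phi> k) x)" and k: "k \<in> {1..Suc d}"
        then have "\<forall>j\<in>{1..d}. cond_density F j (\<phi> j) x \<noteq> 0"
          by (metis ennreal_0 finite_atLeastAtMost less_irrefl prod_zero)
        then show "shape F 1 k x \<in> nef_shapes (kind F k)"
          using elim k by (intro shape_in_nef_shapes[OF F, where \<phi> = \<phi>]) auto
      qed
    qed
  qed
qed

text \<open>
  The last component is a draw from its kernel, given the others. Together with
  the fact that the kernels are probability measures this gives all marginals of the law of one observation.
\<close>

lemma nn_integral_obs_law_Suc:
  assumes F: "valid_family D F" and \<phi>: "\<forall>j\<in>{1..Suc k}. \<phi> j \<in> par_range F j"
    and f: "f \<in> borel_measurable (PiM {1..Suc k} (\<lambda>_. borel))"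
  shows "(\<integral>\<^sup>+x. f x \<partial>obs_law (Suc k) F \<phi>)
    = (\<integral>\<^sup>+x. \<integral>\<^sup>+y. f (x(Suc k := y)) \<partial>nef_law (kind F (Suc k)) (shape F 1 (Suc k) x) (\<phi> (Suc k)) \<partial>obs_law k F \<phi>)"
proof -
  interpret product_sigma_finite "ref_measure F" by (rule product_sigma_finite_ref_measure)
  let ?D = "\<lambda>k x. ennreal (\<Prod>j=1..k. cond_density F j (\<phi> j) x)"
  let ?K = "\<lambda>x. nef_law (kind F (Suc k)) (shape F 1 (Suc k) x) (\<phi> (Suc k))"
  have meas_D: "?D k \<in> borel_measurable (PiM {1..k} (ref_measure F))" for k
    by (rule joint_density_measurable)
  have fm: "f \<in> borel_measurable (PiM {1..Suc k} (ref_measure F))"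
    using f by (simp add: measurable_cong_sets[OF sets_PiM_ref refl])
  have ins: "{1..Suc k} = insert (Suc k) {1..k}" by auto
  have upd[measurable]: "(\<lambda>(x, y). x(Suc k := y)) \<in> (PiM {1..k} (\<lambda>_. borel) \<Otimes>\<^sub>M borel) \<rightarrow>\<^sub>M PiM {1..Suc k} (\<lambda>_. borel :: real measure)"
    unfolding ins by (rule measurable_add_dim)
  have f_upd: "(\<lambda>(x, y). f (x(Suc k := y))) \<in> borel_measurable (PiM {1..k} (\<lambda>_. borel) \<Otimes>\<^sub>M borel)"
    using measurable_compose[OF upd f] by (simp add: case_prod_beta)
  have K: "?K \<in> PiM {1..k} (\<lambda>_. borel) \<rightarrow>\<^sub>M subprob_algebra borel"
    using measurable_compose[OF shape_measurable nef_law_measurable, of "Suc k" k "\<phi> (Suc k)" "kind F (Suc k)" F 1] \<phi>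
    by (simp add: par_range_eq_nef_pars)
  have inner: "(\<lambda>x. \<integral>\<^sup>+y. f (x(Suc k := y)) \<partial>?K x) \<in> borel_measurable (PiM {1..k} (\<lambda>_. borel))"
    by (rule nn_integral_measurable_subprob_algebra2[OF f_upd K])
  have "(\<integral>\<^sup>+x. f x \<partial>obs_law (Suc k) F \<phi>) = (\<integral>\<^sup>+x. ?D (Suc k) x * f x \<partial>PiM {1..Suc k} (ref_measure F))"
    unfolding obs_law_def by (rule nn_integral_density[OF meas_D fm])
  also have "\<dots> = (\<integral>\<^sup>+x. \<integral>\<^sup>+y. ?D (Suc k) (x(Suc k := y)) * f (x(Suc k := y)) \<partial>ref_measure F (Suc k) \<partial>PiM {1..k} (ref_measure F))"
    using borel_measurable_times_ennreal[OF meas_D[of "Suc k"] fm] unfolding ins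
    by (subst product_nn_integral_insert) auto
  also have "\<dots> = (\<integral>\<^sup>+x. ?D k x * (\<integral>\<^sup>+y. f (x(Suc k := y)) \<partial>?K x) \<partial>PiM {1..k} (ref_measure F))"
  proof (rule nn_integral_cong_AE, use AE_regular_points[of k F] AE_space in eventually_elim)
    case (elim x)
    then have x: "x \<in> space (PiM {1..k} (\<lambda>_. borel))" by (simp add: space_PiM_ref)
    have fx: "(\<lambda>y. f (x(Suc k := y))) \<in> borel_measurable borel"
      using measurable_compose[OF measurable_Pair1'[OF x] f_upd] by simp
    have nn: "0 \<le> (\<Prod>j=1..k. cond_density F j (\<phi> j) x)"
      using \<phi> by (intro prod_nonneg cond_density_nonneg) auto
    have D: "?D (Suc k) (x(Suc k := y)) = ?D k x * ennreal (cond_density F (Suc k) (\<phi> (Suc k)) (x(Suc k := y)))" for y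
    proof -
      have "(\<Prod>j=1..k. cond_density F j (\<phi> j) (x(Suc k := y))) = (\<Prod>j=1..k. cond_density F j (\<phi> j) x)"
        by (rule prod.cong) (auto simp: cond_density_upd)
      then show ?thesis using nn by (simp add: ennreal_mult')
    qed
    have cm: "(\<lambda>y. cond_density F (Suc k) (\<phi> (Suc k)) (x(Suc k := y))) \<in> borel_measurable borel"
    proof -
      have "(\<lambda>y. x(Suc k := y)) \<in> borel \<rightarrow>\<^sub>M PiM {1..Suc k} (\<lambda>_. borel)"
        using measurable_compose[OF measurable_Pair1'[OF x] upd] by simp
      from measurable_compose[OF this cond_density_measurable[of "Suc k" "Suc k"]] show ?thesis by simp
    qed
    have p: "0 \<le> prefix_sum x (Suc k)" if "kind F (Suc k) = NegBin \<or> kind F (Suc k) = Gam"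
      using regular_prefix_Nats[of F "Suc k" x] elim(1) that Nats_subset_Ints
      by (auto simp: Nats_def atLeastLessThanSuc_atLeastAtMost)
    have "(\<integral>\<^sup>+y. ?D (Suc k) (x(Suc k := y)) * f (x(Suc k := y)) \<partial>ref_measure F (Suc k))
      = ?D k x * (\<integral>\<^sup>+y. ennreal (cond_density F (Suc k) (\<phi> (Suc k)) (x(Suc k := y))) * f (x(Suc k := y)) \<partial>ref_measure F (Suc k))"
      unfolding D mult.assoc using cm fx by (intro nn_integral_cmult) auto
    also have "\<dots> = ?D k x * (\<integral>\<^sup>+y. f (x(Suc k := y)) \<partial>?K x)"
      using \<phi> p by (subst nn_integral_cond_density[OF F _ _ _ fx]) auto
    finally show ?case .
  qed
  also have "\<dots> = (\<integral>\<^sup>+x. (\<integral>\<^sup>+y. f (x(Suc k := y)) \<partial>?K x) \<partial>obs_law k F \<phi>)"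
    unfolding obs_law_def using inner
    by (intro nn_integral_density[symmetric] meas_D) (simp add: measurable_cong_sets[OF sets_PiM_ref refl])
  finally show ?thesis .
qed

lemma prob_space_obs_law:
  assumes F: "valid_family D F" and \<phi>: "\<forall>j\<in>{1..d}. \<phi> j \<in> par_range F j"
  shows "prob_space (obs_law d F \<phi>)"
  using \<phi>
proof (induction d)
  case 0
  show ?case
    unfolding obs_law_def by (rule prob_spaceI) (simp add: emeasure_density PiM_empty)
next
  case (Suc d)
  then interpret prob_space "obs_law d F \<phi>" by auto
  have "emeasure (obs_law (Suc d) F \<phi>) (space (obs_law (Suc d) F \<phi>)) = (\<integral>\<^sup>+x. 1 \<partial>obs_law (Suc d) F \<phi>)"
    by simp
  also have "\<dots> = (\<integral>\<^sup>+x. \<integral>\<^sup>+y. 1 \<partial>nef_law (kind F (Suc d)) (shape F 1 (Suc d) x) (\<phi> (Suc d)) \<partial>obs_law d F \<phi>)"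
    by (rule nn_integral_obs_law_Suc[OF F Suc.prems]) simp
  also have "\<dots> = (\<integral>\<^sup>+x. 1 \<partial>obs_law d F \<phi>)"
  proof (rule nn_integral_cong_AE, use AE_shape_in_nef_shapes[OF F] in eventually_elim)
    case (elim x)
    then have "prob_space (nef_law (kind F (Suc d)) (shape F 1 (Suc d) x) (\<phi> (Suc d)))"
      using Suc.prems by (intro nef_prob_space) (auto simp: par_range_eq_nef_pars)
    from prob_space.emeasure_space_1[OF this] show ?case by simp
  qed
  also have "\<dots> = 1" by (simp add: emeasure_space_1)
  finally show ?case by (rule prob_spaceI)
qed

lemma nn_integral_obs_law_restrict:
  assumes F: "valid_family D F" and \<phi>: "\<forall>j\<in>{1..d}. \<phi> j \<in> par_range F j" and "k \<le> d"
    and f[measurable]: "f \<in> borel_measurable (PiM {1..k} (\<lambda>_. borel))"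
  shows "(\<integral>\<^sup>+x. f (restrict x {1..k}) \<partial>obs_law d F \<phi>) = (\<integral>\<^sup>+x. f x \<partial>obs_law k F \<phi>)"
  using \<open>k \<le> d\<close> \<phi>
proof (induction d rule: dec_induct)
  case base
  show ?case by (rule nn_integral_cong) (auto simp: space_obs_law space_PiM)
next
  case (step d)
  have m: "(\<lambda>x. f (restrict x {1..k})) \<in> borel_measurable (PiM {1..Suc d} (\<lambda>_. borel))"
    using step by (intro measurable_compose[OF measurable_restrict_subset f]) auto
  have r: "restrict (x(Suc d := y)) {1..k} = restrict x {1..k}" for x :: "nat \<Rightarrow> real" and y
    using step by (auto simp: restrict_def fun_eq_iff)
  have "(\<integral>\<^sup>+x. f (restrict x {1..k}) \<partial>obs_law (Suc d) F \<phi>)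
    = (\<integral>\<^sup>+x. \<integral>\<^sup>+y. f (restrict x {1..k}) \<partial>nef_law (kind F (Suc d)) (shape F 1 (Suc d) x) (\<phi> (Suc d)) \<partial>obs_law d F \<phi>)"
    by (subst nn_integral_obs_law_Suc[OF F step.prems m]) (simp only: r)
  also have "\<dots> = (\<integral>\<^sup>+x. f (restrict x {1..k}) \<partial>obs_law d F \<phi>)"
  proof (rule nn_integral_cong_AE, use AE_shape_in_nef_shapes[OF F] in eventually_elim)
    case (elim x)
    then have "prob_space (nef_law (kind F (Suc d)) (shape F 1 (Suc d) x) (\<phi> (Suc d)))"
      using step.prems by (intro nef_prob_space) (auto simp: par_range_eq_nef_pars)
    from prob_space.emeasure_space_1[OF this] show ?case by simp
  qed
  also have "\<dots> = (\<integral>\<^sup>+x. f x \<partial>obs_law k F \<phi>)"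
    using step.prems by (intro step.IH) auto
  finally show ?case .
qed

section \<open>Conditional laws of the sample sums\<close>

lemma shape_cong:
  "1 \<le> k \<Longrightarrow> (\<And>j. j \<in> {1..<k} \<Longrightarrow> x j = y j) \<Longrightarrow> shape F n k x = shape F n k y"
  by (cases F) (auto simp: prefix_sum_def intro!: sum.cong)

text \<open>
  A crude Lipschitz bound; it turns a neighbourhood of the conditioning point into one of the
  convolution parameter.
\<close>

lemma shape_close:
  assumes k: "1 \<le> k" and close: "\<And>j. j \<in> {1..<k} \<Longrightarrow> \<bar>x j - s j\<bar> < \<epsilon>" and \<epsilon>: "0 < \<epsilon>"
  shows "\<bar>shape F n k x - shape F n k s\<bar> \<le> real k * \<epsilon>"
proof -
  have "\<bar>prefix_sum x k - prefix_sum s k\<bar> \<le> (\<Sum>j=1..<k. \<bar>x j - s j\<bar>)"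
    unfolding prefix_sum_def sum_subtractf[symmetric] by (rule sum_abs)
  also have "\<dots> \<le> (\<Sum>j=1..<k. \<epsilon>)" using close by (intro sum_mono less_imp_le) auto
  also have "\<dots> \<le> real k * \<epsilon>" using \<epsilon> by (simp add: mult_right_mono)
  finally have p: "\<bar>prefix_sum x k - prefix_sum s k\<bar> \<le> real k * \<epsilon>" .
  have "1 * \<epsilon> \<le> real k * \<epsilon>" using k \<epsilon> by (intro mult_right_mono) auto
  then have e: "\<epsilon> \<le> real k * \<epsilon>" by simp
  show ?thesis
  proof (cases F)
    case (NM_Gamma_Normal m R)
    then show ?thesis using p e close[of "m + 1"] by (cases "k \<le> m + 1") auto
  qed (use p e \<epsilon> in auto)
qed

lemma par_spaceD: "\<phi> \<in> par_space d F \<Longrightarrow> \<forall>j\<in>{1..d}. \<phi> j \<in> par_range F j"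
  by (auto simp: par_space_def PiE_iff)

lemma prob_space_sample_law:
  assumes "valid_family d F" "\<phi> \<in> par_space d F"
  shows "prob_space (sample_law n d F \<phi>)"
  unfolding sample_law_def
  by (intro prob_space_PiM prob_space_obs_law[OF assms(1)] par_spaceD assms)

lemma obs_law_component [measurable]: "j \<in> {1..d} \<Longrightarrow> (\<lambda>x. x j) \<in> borel_measurable (obs_law d F \<phi>)"
  by (simp add: measurable_cong_sets[OF sets_obs_law refl] measurable_component_singleton)

lemma sample_sum_measurable [measurable]:
  assumes "j \<in> {1..d}"
  shows "sample_sum n j \<in> borel_measurable (sample_law n d F \<phi>)"
proof -
  have "(\<lambda>\<omega>. \<Sum>i=1..n. \<omega> i j) \<in> borel_measurable (sample_law n d F \<phi>)"
  proof (intro borel_measurable_sum)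
    fix i assume "i \<in> {1..n}"
    then have "(\<lambda>\<omega>. \<omega> i) \<in> sample_law n d F \<phi> \<rightarrow>\<^sub>M obs_law d F \<phi>"
      unfolding sample_law_def by (rule measurable_component_singleton)
    from measurable_compose[OF this obs_law_component[OF assms]]
    show "(\<lambda>\<omega>. \<omega> i j) \<in> borel_measurable (sample_law n d F \<phi>)" .
  qed
  then show ?thesis by (simp add: sample_sum_def[abs_def])
qed

text \<open>
  The identity lives on the first \<open>k\<close> components, so both sides are moved to \<open>obs_law k\<close> and
  \<open>obs_law (k - 1)\<close> by marginalization.
\<close>

lemma obs_law_disintegration:
  assumes F: "valid_family d F" and \<phi>: "\<phi> \<in> par_space d F" and k: "k \<in> {1..d}"
    and A: "A \<in> sets borel" and B: "\<And>j. j \<in> {1..<k} \<Longrightarrow> B j \<in> sets borel"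
  shows "(\<integral>\<^sup>+x. indicator A (x k) * (\<Prod>j\<in>{1..<k}. indicator (B j) (x j)) \<partial>obs_law d F \<phi>)
    = (\<integral>\<^sup>+x. emeasure (nef_law (kind F k) (shape F 1 k x) (\<phi> k)) A * (\<Prod>j\<in>{1..<k}. indicator (B j) (x j)) \<partial>obs_law d F \<phi>)"
proof -
  obtain l where l: "k = Suc l" using k by (cases k) auto
  have ll: "{1..<k} = {1..l}" by (auto simp: l)
  let ?W = "\<lambda>x. \<Prod>j\<in>{1..<k}. indicator (B j) (x j) :: ennreal"
  let ?K = "\<lambda>x. nef_law (kind F k) (shape F 1 k x) (\<phi> k)"
  note par = par_spaceD[OF \<phi>]
  have Wm: "?W \<in> borel_measurable (PiM {1..i} (\<lambda>_. borel))" if "l \<le> i" for i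
  proof (rule borel_measurable_prod_ennreal)
    fix j assume j: "j \<in> {1..<k}"
    have "(\<lambda>x. x j) \<in> borel_measurable (PiM {1..i} (\<lambda>_. borel :: real measure))"
      using j that l by (intro measurable_component_singleton) auto
    from measurable_compose[OF this borel_measurable_indicator[OF B[OF j]]]
    show "(\<lambda>x. indicator (B j) (x j) :: ennreal) \<in> borel_measurable (PiM {1..i} (\<lambda>_. borel))" .
  qed
  have fm: "(\<lambda>x. indicator A (x k) * ?W x) \<in> borel_measurable (PiM {1..k} (\<lambda>_. borel))"
    using k l A
    by (intro borel_measurable_times_ennreal Wm
         measurable_compose[OF measurable_component_singleton borel_measurable_indicator]) auto
  have gm: "(\<lambda>x. emeasure (?K x) A * ?W x) \<in> borel_measurable (PiM {1..l} (\<lambda>_. borel))"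
  proof (intro borel_measurable_times_ennreal Wm order_refl)
    have "?K \<in> PiM {1..l} (\<lambda>_. borel) \<rightarrow>\<^sub>M subprob_algebra borel"
      using measurable_compose[OF shape_measurable nef_law_measurable, of k l "\<phi> k" "kind F k" F 1] par k l
      by (simp add: par_range_eq_nef_pars)
    from measurable_compose[OF this measurable_emeasure_subprob_algebra[OF A]]
    show "(\<lambda>x. emeasure (?K x) A) \<in> borel_measurable (PiM {1..l} (\<lambda>_. borel))" .
  qed
  have W_restrict: "?W (restrict x {1..i}) = ?W x" if "l \<le> i" for i x
    using that l by (intro prod.cong) auto
  have "(\<integral>\<^sup>+x. indicator A (x k) * ?W x \<partial>obs_law d F \<phi>)
      = (\<integral>\<^sup>+x. indicator A (restrict x {1..k} k) * ?W (restrict x {1..k}) \<partial>obs_law d F \<phi>)"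
    using k l by (subst W_restrict) auto
  also have "\<dots> = (\<integral>\<^sup>+x. indicator A (x k) * ?W x \<partial>obs_law k F \<phi>)"
    using k by (intro nn_integral_obs_law_restrict[OF F par _ fm]) auto
  also have "\<dots> = (\<integral>\<^sup>+x. \<integral>\<^sup>+y. indicator A ((x(k := y)) k) * ?W (x(k := y)) \<partial>?K x \<partial>obs_law l F \<phi>)"
    using fm par k unfolding l by (intro nn_integral_obs_law_Suc[OF F]) auto
  also have "\<dots> = (\<integral>\<^sup>+x. \<integral>\<^sup>+y. indicator A y * ?W x \<partial>?K x \<partial>obs_law l F \<phi>)"
  proof (intro nn_integral_cong)
    fix x :: "nat \<Rightarrow> real" and y :: real
    have "?W (x(k := y)) = ?W x" by (intro prod.cong) auto
    then show "indicator A ((x(k := y)) k) * ?W (x(k := y)) = indicator A y * ?W x" by simp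
  qed
  also have "\<dots> = (\<integral>\<^sup>+x. emeasure (?K x) A * ?W x \<partial>obs_law l F \<phi>)"
    using A by (intro nn_integral_cong)
      (subst nn_integral_multc, auto simp: measurable_cong_sets[OF sets_nef_law refl])
  also have "\<dots> = (\<integral>\<^sup>+x. emeasure (?K (restrict x {1..l})) A * ?W (restrict x {1..l}) \<partial>obs_law d F \<phi>)"
    using k l par by (intro nn_integral_obs_law_restrict[OF F _ _ gm, symmetric]) auto
  also have "\<dots> = (\<integral>\<^sup>+x. emeasure (?K x) A * ?W x \<partial>obs_law d F \<phi>)"
  proof (intro nn_integral_cong)
    fix x :: "nat \<Rightarrow> real"
    have "shape F 1 k (restrict x {1..l}) = shape F 1 k x" using k l by (intro shape_cong) auto
    then show "emeasure (?K (restrict x {1..l})) A * ?W (restrict x {1..l}) = emeasure (?K x) A * ?W x"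
      by (subst W_restrict) auto
  qed
  finally show ?thesis .
qed

lemma sum_shape_sample: "(\<Sum>i=1..n. shape F 1 k (\<omega> i)) = shape F n k (\<lambda>j. sample_sum n j \<omega>)"
  using shape_sum[of "{1..n}" F k \<omega>] by (simp add: sample_sum_def)

text \<open>
  The conditional law of the \<open>k\<close>-th sample sum given the previous ones, in integrated form.
\<close>

lemma sample_sum_disintegration:
  assumes n: "1 \<le> n" and F: "valid_family d F" and \<phi>: "\<phi> \<in> par_space d F" and k: "k \<in> {1..d}"
  shows "A \<in> sets borel \<Longrightarrow> (\<And>j. j \<in> {1..<k} \<Longrightarrow> B j \<in> sets borel) \<Longrightarrow>
    (\<integral>\<^sup>+\<omega>. indicator A (sample_sum n k \<omega>) * (\<Prod>j\<in>{1..<k}. indicator (B j) (sample_sum n j \<omega>)) \<partial>sample_law n d F \<phi>)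
    = (\<integral>\<^sup>+\<omega>. emeasure (nef_law (kind F k) (shape F n k (\<lambda>j. sample_sum n j \<omega>)) (\<phi> k)) A *
         (\<Prod>j\<in>{1..<k}. indicator (B j) (sample_sum n j \<omega>)) \<partial>sample_law n d F \<phi>)"
    and "AE \<omega> in sample_law n d F \<phi>. shape F n k (\<lambda>j. sample_sum n j \<omega>) \<in> nef_shapes (kind F k)"
proof -
  let ?P = "obs_law d F \<phi>"
  have par: "\<phi> k \<in> nef_pars (kind F k)"
    using par_spaceD[OF \<phi>] k by (simp add: par_range_eq_nef_pars)
  have c: "shape F 1 k \<in> borel_measurable ?P"
    using k shape_measurable[of k d F 1] by (simp add: measurable_cong_sets[OF sets_obs_law refl])
  have AE: "AE x in ?P. shape F 1 k x \<in> nef_shapes (kind F k)"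
    using AE_shape_in_nef_shapes[OF F, of d \<phi>] k by (auto elim!: eventually_mono)
  note D = iid_sum_disintegration[where P = ?P and J = "{1..<k}" and Y = "\<lambda>x. x k"
      and c = "shape F 1 k" and V = "\<lambda>j x. x j" and K = "\<lambda>c. nef_law (kind F k) c (\<phi> k)"
      and T = "nef_shapes (kind F k)" and I = "{1..n}"]
  have P: "prob_space ?P" by (rule prob_space_obs_law[OF F par_spaceD[OF \<phi>]])
  have V: "(\<lambda>x. x j) \<in> borel_measurable ?P" if "j \<in> {1..<k}" for j
    using that k by (intro obs_law_component) auto
  have I: "finite {1..n}" "{1..n} \<noteq> {}" using n by auto
  note D = D[OF P finite_atLeastLessThan obs_law_component[OF k] c V nef_law_measurable[OF par]
      nef_shapes_add nef_convolution[OF par] AE obs_law_disintegration[OF F \<phi> k] I, folded sample_law_def,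
      unfolded sum_shape_sample, folded sample_sum_def]
  show "AE \<omega> in sample_law n d F \<phi>. shape F n k (\<lambda>j. sample_sum n j \<omega>) \<in> nef_shapes (kind F k)"
    by (rule D(2))
  show "(\<integral>\<^sup>+\<omega>. indicator A (sample_sum n k \<omega>) * (\<Prod>j\<in>{1..<k}. indicator (B j) (sample_sum n j \<omega>)) \<partial>sample_law n d F \<phi>)
    = (\<integral>\<^sup>+\<omega>. emeasure (nef_law (kind F k) (shape F n k (\<lambda>j. sample_sum n j \<omega>)) (\<phi> k)) A *
         (\<Prod>j\<in>{1..<k}. indicator (B j) (sample_sum n j \<omega>)) \<partial>sample_law n d F \<phi>)"
    if "A \<in> sets borel" "\<And>j. j \<in> {1..<k} \<Longrightarrow> B j \<in> sets borel"
    by (rule D(1)) (assumption | rule that)+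
qed

definition near :: "nat \<Rightarrow> nat \<Rightarrow> (nat \<Rightarrow> real) \<Rightarrow> real \<Rightarrow> (nat \<Rightarrow> nat \<Rightarrow> real) \<Rightarrow> bool" where
  "near n k s \<epsilon> \<omega> \<longleftrightarrow> (\<forall>j\<in>{1..<k}. \<bar>sample_sum n j \<omega> - s j\<bar> < \<epsilon>)"

lemma S_given_eq_Lim:
  "S_given n d F \<phi> k s A = Lim (at_right 0) (\<lambda>\<epsilon>.
     cond_prob (sample_law n d F \<phi>) (\<lambda>\<omega>. sample_sum n k \<omega> \<in> A) (near n k s \<epsilon>))"
  by (simp add: S_given_def prob_given_def near_def[abs_def])

lemma near_measurable [measurable]:
  assumes "k \<in> {1..d}"
  shows "Measurable.pred (sample_law n d F \<phi>) (near n k s \<epsilon>)"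
proof -
  have "Measurable.pred (sample_law n d F \<phi>) (\<lambda>\<omega>. \<forall>j\<in>{1..<k}. \<bar>sample_sum n j \<omega> - s j\<bar> < \<epsilon>)"
  proof (rule pred_intros_finite(3))
    fix j assume "j \<in> {1..<k}"
    then have [measurable]: "sample_sum n j \<in> borel_measurable (sample_law n d F \<phi>)"
      using assms by (intro sample_sum_measurable) auto
    show "Measurable.pred (sample_law n d F \<phi>) (\<lambda>\<omega>. \<bar>sample_sum n j \<omega> - s j\<bar> < \<epsilon>)"
      by measurable
  qed simp
  then show ?thesis by (simp add: near_def[abs_def])
qed

text \<open>
  An average of the kernel over a neighbourhood lies between the extreme values of the kernel there.
\<close>

lemma cond_prob_near_bounds:
  assumes n: "1 \<le> n" and F: "valid_family d F" and \<phi>: "\<phi> \<in> par_space d F" and k: "k \<in> {1..d}"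
    and A: "A \<in> sets borel"
    and pos: "0 < measure (sample_law n d F \<phi>) {\<omega> \<in> space (sample_law n d F \<phi>). near n k s \<epsilon> \<omega>}"
    and bnd: "\<And>\<omega>. near n k s \<epsilon> \<omega> \<Longrightarrow> shape F n k (\<lambda>j. sample_sum n j \<omega>) \<in> nef_shapes (kind F k) \<Longrightarrow>
      measure (nef_law (kind F k) (shape F n k (\<lambda>j. sample_sum n j \<omega>)) (\<phi> k)) A \<in> {a..b}"
  shows "cond_prob (sample_law n d F \<phi>) (\<lambda>\<omega>. sample_sum n k \<omega> \<in> A) (near n k s \<epsilon>) \<in> {a..b}"
proof -
  let ?M = "sample_law n d F \<phi>"
  let ?C = "\<lambda>\<omega>. shape F n k (\<lambda>j. sample_sum n j \<omega>)"
  let ?K = "\<lambda>\<omega>. nef_law (kind F k) (?C \<omega>) (\<phi> k)"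
  let ?E = "{\<omega> \<in> space ?M. near n k s \<epsilon> \<omega>}"
  let ?AE = "{\<omega> \<in> space ?M. sample_sum n k \<omega> \<in> A \<and> near n k s \<epsilon> \<omega>}"
  interpret prob_space ?M by (rule prob_space_sample_law[OF F \<phi>])
  have E: "?E \<in> sets ?M" using near_measurable[OF k] by (simp add: pred_def)
  have Ak: "Measurable.pred ?M (\<lambda>\<omega>. sample_sum n k \<omega> \<in> A)"
    using A sample_sum_measurable[OF k] by measurable
  have AE: "?AE \<in> sets ?M"
    using sets.sets_Collect_conj[OF near_measurable[OF k, unfolded pred_def] Ak[unfolded pred_def]] by simp
  have t: "\<phi> k \<in> nef_pars (kind F k)"
    using par_spaceD[OF \<phi>] k by (simp add: par_range_eq_nef_pars)
  define B where "B j = {s j - \<epsilon><..<s j + \<epsilon>}" for j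
  have ind: "(\<Prod>j\<in>{1..<k}. indicator (B j) (sample_sum n j \<omega>)) = (indicator ?E \<omega> :: ennreal)"
    if "\<omega> \<in> space ?M" for \<omega>
  proof (cases "near n k s \<epsilon> \<omega>")
    case True
    then have "(\<Prod>j\<in>{1..<k}. indicator (B j) (sample_sum n j \<omega>)) = (1 :: ennreal)"
      by (intro prod.neutral) (auto simp: near_def B_def abs_less_iff indicator_def algebra_simps)
    with True that show ?thesis by simp
  next
    case False
    then obtain j where "j \<in> {1..<k}" "sample_sum n j \<omega> \<notin> B j"
      by (auto simp: near_def B_def abs_less_iff algebra_simps)
    then have "(\<Prod>j\<in>{1..<k}. indicator (B j) (sample_sum n j \<omega>)) = (0 :: ennreal)"
      by (intro prod_zero bexI[of _ j]) auto
    with False show ?thesis by simp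
  qed
  have "emeasure ?M ?AE = (\<integral>\<^sup>+\<omega>. indicator ?AE \<omega> \<partial>?M)" using AE by simp
  also have "\<dots> = (\<integral>\<^sup>+\<omega>. indicator A (sample_sum n k \<omega>) * (\<Prod>j\<in>{1..<k}. indicator (B j) (sample_sum n j \<omega>)) \<partial>?M)"
    by (intro nn_integral_cong, simp only: ind) (auto simp: indicator_def)
  also have "\<dots> = (\<integral>\<^sup>+\<omega>. emeasure (?K \<omega>) A * (\<Prod>j\<in>{1..<k}. indicator (B j) (sample_sum n j \<omega>)) \<partial>?M)"
    by (rule sample_sum_disintegration(1)[OF n F \<phi> k A]) (simp add: B_def)
  also have "\<dots> = (\<integral>\<^sup>+\<omega>. emeasure (?K \<omega>) A * indicator ?E \<omega> \<partial>?M)"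
    by (intro nn_integral_cong, simp only: ind)
  finally have eq: "emeasure ?M ?AE = (\<integral>\<^sup>+\<omega>. emeasure (?K \<omega>) A * indicator ?E \<omega> \<partial>?M)" .
  have K: "emeasure (?K \<omega>) A = ennreal (measure (?K \<omega>) A)" "measure (?K \<omega>) A \<in> {a..b}"
    if "near n k s \<epsilon> \<omega>" "?C \<omega> \<in> nef_shapes (kind F k)" for \<omega>
  proof -
    interpret K: prob_space "?K \<omega>" by (rule nef_prob_space[OF t that(2)])
    show "emeasure (?K \<omega>) A = ennreal (measure (?K \<omega>) A)" by (rule K.emeasure_eq_measure)
    show "measure (?K \<omega>) A \<in> {a..b}" by (rule bnd[OF that])
  qed
  note AET = sample_sum_disintegration(2)[OF n F \<phi> k]
  have "ennreal (measure ?M ?AE) \<le> (\<integral>\<^sup>+\<omega>. ennreal b * indicator ?E \<omega> \<partial>?M)"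
    unfolding emeasure_eq_measure[symmetric] eq
  proof (rule nn_integral_mono_AE, use AET in eventually_elim)
    case (elim \<omega>)
    then show ?case using K[of \<omega>] by (auto simp: indicator_def intro!: ennreal_leI)
  qed
  also have "\<dots> = ennreal b * ennreal (measure ?M ?E)"
    using E by (simp add: nn_integral_cmult_indicator emeasure_eq_measure)
  finally have up0: "ennreal (measure ?M ?AE) \<le> ennreal b * ennreal (measure ?M ?E)" .
  have "(\<integral>\<^sup>+\<omega>. ennreal a * indicator ?E \<omega> \<partial>?M) \<le> ennreal (measure ?M ?AE)"
    unfolding emeasure_eq_measure[symmetric] eq
  proof (rule nn_integral_mono_AE, use AET in eventually_elim)
    case (elim \<omega>)
    then show ?case using K[of \<omega>] by (auto simp: indicator_def intro!: ennreal_leI)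
  qed
  then have lo0: "ennreal a * ennreal (measure ?M ?E) \<le> ennreal (measure ?M ?AE)"
    using E by (simp add: nn_integral_cmult_indicator emeasure_eq_measure)
  have b: "0 \<le> b"
  proof -
    have "\<not> (AE \<omega> in ?M. \<not> near n k s \<epsilon> \<omega>)"
      using pos E by (simp add: AE_iff_measurable[OF _ refl] emeasure_eq_measure)
    then obtain \<omega> where "near n k s \<epsilon> \<omega>" "?C \<omega> \<in> nef_shapes (kind F k)"
      using AET by (metis (mono_tags, lifting) eventually_mono)
    from bnd[OF this] show ?thesis by (auto intro: order_trans[OF measure_nonneg])
  qed
  have up: "measure ?M ?AE \<le> b * measure ?M ?E"
    using up0 b by (simp add: ennreal_mult'[symmetric])
  have lo: "a * measure ?M ?E \<le> measure ?M ?AE"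
  proof (cases "0 \<le> a")
    case True
    then show ?thesis using lo0 by (simp add: ennreal_mult'[symmetric])
  next
    case False
    then have "a * measure ?M ?E \<le> 0" by (intro mult_nonpos_nonneg) auto
    then show ?thesis by (rule order_trans) simp
  qed
  show ?thesis
    using up lo pos by (simp add: cond_prob_def pos_divide_le_eq pos_le_divide_eq)
qed

text \<open>
  The averages of the kernel over shrinking neighbourhoods converge to its value at the conditioning
  point, since the kernel is continuous on the range of its convolution parameter.
\<close>

lemma S_given_eq_nef_law:
  assumes n: "1 \<le> n" and F: "valid_family d F" and \<phi>: "\<phi> \<in> par_space d F" and k: "k \<in> {1..d}"
    and pos: "\<And>\<epsilon>. 0 < \<epsilon> \<Longrightarrow> 0 < measure (sample_law n d F \<phi>) {\<omega> \<in> space (sample_law n d F \<phi>). near n k s \<epsilon> \<omega>}"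
    and c: "shape F n k s \<in> nef_shapes (kind F k)"
    and A: "A \<in> sets borel" "kind F k = Norm \<Longrightarrow> \<exists>y. A = {..y}"
  shows "S_given n d F \<phi> k s A = measure (nef_law (kind F k) (shape F n k s) (\<phi> k)) A"
proof -
  let ?M = "sample_law n d F \<phi>"
  let ?G = "\<lambda>c. measure (nef_law (kind F k) c (\<phi> k)) A"
  let ?c = "shape F n k s"
  have "((\<lambda>\<epsilon>. cond_prob ?M (\<lambda>\<omega>. sample_sum n k \<omega> \<in> A) (near n k s \<epsilon>)) \<longlongrightarrow> ?G ?c) (at_right 0)"
  proof (rule tendstoI)
    fix \<delta> :: real assume \<delta>: "0 < \<delta>"
    have "eventually (\<lambda>c'. dist (?G c') (?G ?c) < \<delta> / 2) (at ?c within nef_shapes (kind F k))"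
      using tendstoD[OF nef_law_tendsto[OF c A(2)], of "\<delta> / 2"] \<delta> by auto
    then obtain \<eta> where \<eta>: "0 < \<eta>"
      and G: "\<And>c'. c' \<in> nef_shapes (kind F k) \<Longrightarrow> \<bar>c' - ?c\<bar> < \<eta> \<Longrightarrow> \<bar>?G c' - ?G ?c\<bar> \<le> \<delta> / 2"
      unfolding eventually_at dist_real_def using \<delta> by (force intro: less_imp_le)
    have kpos: "0 < real k" using k by simp
    show "eventually (\<lambda>\<epsilon>. dist (cond_prob ?M (\<lambda>\<omega>. sample_sum n k \<omega> \<in> A) (near n k s \<epsilon>)) (?G ?c) < \<delta>) (at_right 0)"
      unfolding eventually_at_right_field
    proof (intro exI[of _ "\<eta> / real k"] conjI allI impI)
      show "0 < \<eta> / real k" using \<eta> kpos by simp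
      fix \<epsilon> assume \<epsilon>: "0 < \<epsilon>" "\<epsilon> < \<eta> / real k"
      have "cond_prob ?M (\<lambda>\<omega>. sample_sum n k \<omega> \<in> A) (near n k s \<epsilon>) \<in> {?G ?c - \<delta> / 2..?G ?c + \<delta> / 2}"
      proof (rule cond_prob_near_bounds[OF n F \<phi> k A(1) pos[OF \<epsilon>(1)]])
        fix \<omega> assume near: "near n k s \<epsilon> \<omega>" and C: "shape F n k (\<lambda>j. sample_sum n j \<omega>) \<in> nef_shapes (kind F k)"
        have "\<bar>shape F n k (\<lambda>j. sample_sum n j \<omega>) - ?c\<bar> \<le> real k * \<epsilon>"
          using near k \<epsilon> by (intro shape_close) (auto simp: near_def)
        also have "\<dots> < \<eta>" using \<epsilon> kpos by (simp add: pos_less_divide_eq mult.commute)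
        finally have "\<bar>shape F n k (\<lambda>j. sample_sum n j \<omega>) - ?c\<bar> < \<eta>" .
        from G[OF C this]
        show "?G (shape F n k (\<lambda>j. sample_sum n j \<omega>)) \<in> {?G ?c - \<delta> / 2..?G ?c + \<delta> / 2}"
          unfolding atLeastAtMost_iff by linarith
      qed
      then show "dist (cond_prob ?M (\<lambda>\<omega>. sample_sum n k \<omega> \<in> A) (near n k s \<epsilon>)) (?G ?c) < \<delta>"
        using \<delta> by (auto simp: dist_real_def abs_less_iff)
    qed
  qed
  then show ?thesis
    unfolding S_given_eq_Lim by (intro tendsto_Lim) auto
qed

text \<open>
  If some neighbourhood of the conditioning point were null, then all conditional probabilities
  would be quotients by zero, hence zero, and the conditional support would be empty.
\<close>

lemma admissible_near_pos:
  assumes adm: "admissible n d F s" and F: "valid_family d F" and \<phi>: "\<phi> \<in> par_space d F" and k: "k \<in> {1..d}"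
    and \<epsilon>: "0 < \<epsilon>"
  shows "0 < measure (sample_law n d F \<phi>) {\<omega> \<in> space (sample_law n d F \<phi>). near n k s \<epsilon> \<omega>}"
proof (rule ccontr)
  let ?M = "sample_law n d F \<phi>"
  interpret prob_space ?M by (rule prob_space_sample_law[OF F \<phi>])
  assume "\<not> 0 < measure ?M {\<omega> \<in> space ?M. near n k s \<epsilon> \<omega>}"
  then have 0: "measure ?M {\<omega> \<in> space ?M. near n k s \<epsilon> \<omega>} = 0"
    using zero_less_measure_iff by blast
  have "cond_prob ?M (\<lambda>\<omega>. sample_sum n k \<omega> \<in> A) (near n k s \<delta>) = 0" if "\<delta> < \<epsilon>" for A \<delta>
  proof -
    have "measure ?M {\<omega> \<in> space ?M. near n k s \<delta> \<omega>} \<le> measure ?M {\<omega> \<in> space ?M. near n k s \<epsilon> \<omega>}"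
      using near_measurable[OF k] that
      by (intro finite_measure_mono) (auto simp: near_def pred_def)
    then have "measure ?M {\<omega> \<in> space ?M. near n k s \<delta> \<omega>} = 0"
      using 0 by (simp add: measure_le_0_iff)
    then show ?thesis by (simp add: cond_prob_def)
  qed
  then have "eventually (\<lambda>\<delta>. cond_prob ?M (\<lambda>\<omega>. sample_sum n k \<omega> \<in> A) (near n k s \<delta>) = 0) (at_right 0)" for A
    unfolding eventually_at_right_field using \<epsilon> by auto
  then have "((\<lambda>\<delta>. cond_prob ?M (\<lambda>\<omega>. sample_sum n k \<omega> \<in> A) (near n k s \<delta>)) \<longlongrightarrow> 0) (at_right 0)" for A
    by (rule tendsto_eventually)
  then have "S_given n d F \<phi> k s A = 0" for A
    unfolding S_given_eq_Lim by (intro tendsto_Lim) auto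
  then have "cond_support n d F \<phi> k s = {}"
    by (auto simp: cond_support_def intro: exI[of _ 1])
  moreover have "s k \<in> cond_support n d F \<phi> k s"
    using adm \<phi> k by (auto simp: admissible_def Let_def)
  ultimately show False by simp
qed

section \<open>Consequences of admissibility\<close>

definition nef_support :: "nef \<Rightarrow> real \<Rightarrow> real \<Rightarrow> real set" where
  "nef_support \<kappa> c t = {y. \<forall>\<delta>>0. 0 < measure (nef_law \<kappa> c t) {y - \<delta><..<y + \<delta>}}"

lemma nef_support_avoid:
  assumes "y \<in> nef_support \<kappa> c t" "open U" "y \<in> U"
    and null: "\<And>A. A \<in> sets borel \<Longrightarrow> A \<subseteq> U \<Longrightarrow> measure (nef_law \<kappa> c t) A = 0"
  shows False
proof -
  obtain \<delta> where \<delta>: "0 < \<delta>" "\<And>z. dist z y < \<delta> \<Longrightarrow> z \<in> U"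
    using assms(2,3) unfolding open_dist by blast
  have "{y - \<delta><..<y + \<delta>} \<subseteq> U"
    using \<delta>(2) by (auto simp: dist_real_def abs_less_iff)
  then have "measure (nef_law \<kappa> c t) {y - \<delta><..<y + \<delta>} = 0" by (intro null) auto
  with assms(1) \<delta>(1) show False by (force simp: nef_support_def)
qed

lemma nef_support_Nats:
  assumes "\<kappa> \<in> {Poi, Bin, NegBin}"
  shows "nef_support \<kappa> c t \<subseteq> \<nat>"
proof (rule subsetI, rule ccontr)
  fix y assume y: "y \<in> nef_support \<kappa> c t" "y \<notin> \<nat>"
  obtain p where p: "nef_law \<kappa> c t = nat_law p" using assms by auto
  show False
    by (rule nef_support_avoid[OF y(1), of "- \<nat>"])
       (use y(2) in \<open>auto simp: p intro!: nat_law_null\<close>)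
qed

lemma nef_support_Bin:
  assumes "c \<in> nef_shapes Bin"
  shows "nef_support Bin c t \<subseteq> {..c}"
proof (rule subsetI, rule ccontr)
  fix y assume y: "y \<in> nef_support Bin c t" "y \<notin> {..c}"
  obtain m where m: "c = real m" using assms by (auto simp: Nats_def)
  have p: "0 < exp t / (1 + exp t)" "exp t / (1 + exp t) < 1"
    by (simp_all add: field_simps add_pos_pos)
  show False
    by (rule nef_support_avoid[OF y(1), of "{c<..}"])
       (use y(2) p in \<open>force simp: m intro!: nat_law_null\<close>)+
qed

lemma Gam_law_null:
  assumes "A \<in> sets borel" "A \<subseteq> {..<0} \<or> A \<subseteq> {a}"
  shows "measure (nef_law Gam c t) A = 0"
proof -
  have "AE y in lborel. y \<noteq> a" by (rule AE_lborel_singleton)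
  then have "AE y in lborel. ennreal (erlang_density (nat \<lfloor>c\<rfloor> - 1) (- t) y) * indicator A y = 0"
    using assms(2) by (auto elim!: eventually_mono simp: indicator_def erlang_density_def)
  then have "(\<integral>\<^sup>+y. ennreal (erlang_density (nat \<lfloor>c\<rfloor> - 1) (- t) y) * indicator A y \<partial>lborel) = 0"
    using assms(1) by (subst nn_integral_0_iff_AE) auto
  then show ?thesis
    using assms(1) by (simp add: measure_def emeasure_density)
qed

lemma nef_support_Gam: "nef_support Gam c t \<subseteq> {0..}"
proof (rule subsetI, rule ccontr)
  fix y assume y: "y \<in> nef_support Gam c t" "y \<notin> {0..}"
  show False
    by (rule nef_support_avoid[OF y(1), of "{..<0}"])
       (use y(2) in \<open>auto intro!: Gam_law_null simp del: nef_law.simps\<close>)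
qed

lemma par_space_nonempty: "\<exists>\<phi>. \<phi> \<in> par_space d F"
proof -
  have "\<exists>t. t \<in> par_range F k" for k
    by (cases F) (auto intro: exI[of _ "- 1 :: real"])
  then have "restrict (\<lambda>k. SOME t. t \<in> par_range F k) {1..d} \<in> par_space d F"
    by (auto simp: par_space_def intro: someI_ex)
  then show ?thesis by blast
qed

text \<open>
  By this closedness the convolution parameter at the observed sums, being a limit of values attained
  with positive probability, is in range. For the normal law the range is open, and its
  parameter is handled separately.
\<close>

lemma closed_nef_shapes: "\<kappa> \<noteq> Norm \<Longrightarrow> closed (nef_shapes \<kappa>)"
proof -
  have "{c \<in> \<nat>. 1 \<le> c} = \<nat> \<inter> {1::real..}" by auto
  then have "closed {c \<in> \<nat>. (1::real) \<le> c}" by (simp add: closed_Int)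
  then show "\<kappa> \<noteq> Norm \<Longrightarrow> closed (nef_shapes \<kappa>)" by (cases \<kappa>) auto
qed

lemma admissible_discrete_shape:
  assumes n: "1 \<le> n" and F: "valid_family d F" and adm: "admissible n d F s"
    and k: "k \<in> {1..d}" and \<kappa>: "kind F k \<noteq> Norm"
  shows "shape F n k s \<in> nef_shapes (kind F k)"
proof -
  obtain \<phi> where \<phi>: "\<phi> \<in> par_space d F" using par_space_nonempty by blast
  let ?M = "sample_law n d F \<phi>"
  interpret prob_space ?M by (rule prob_space_sample_law[OF F \<phi>])
  have "\<exists>c\<in>nef_shapes (kind F k). dist c (shape F n k s) < e" if e: "0 < e" for e
  proof -
    \<comment> \<open>The factor 2 turns the weak Lipschitz bound into a strict one.\<close>
    define \<epsilon> where "\<epsilon> = e / (2 * real k)"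
    have \<epsilon>: "0 < \<epsilon>" and ke: "real k * \<epsilon> < e" using e k by (auto simp: \<epsilon>_def field_simps)
    have E: "{\<omega> \<in> space ?M. near n k s \<epsilon> \<omega>} \<in> sets ?M"
      using near_measurable[OF k] by (simp add: pred_def)
    have "\<not> (AE \<omega> in ?M. \<not> near n k s \<epsilon> \<omega>)"
      using admissible_near_pos[OF adm F \<phi> k \<epsilon>] E
      by (simp add: AE_iff_measurable[OF _ refl] emeasure_eq_measure)
    then obtain \<omega> where \<omega>: "near n k s \<epsilon> \<omega>" "shape F n k (\<lambda>j. sample_sum n j \<omega>) \<in> nef_shapes (kind F k)"
      using sample_sum_disintegration(2)[OF n F \<phi> k] by (metis (mono_tags, lifting) eventually_mono)
    have "\<bar>shape F n k (\<lambda>j. sample_sum n j \<omega>) - shape F n k s\<bar> \<le> real k * \<epsilon>"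
      using \<omega>(1) k \<epsilon> by (intro shape_close) (auto simp: near_def)
    with ke \<omega>(2) show ?thesis by (intro bexI[of _ "shape F n k (\<lambda>j. sample_sum n j \<omega>)"]) (auto simp: dist_real_def)
  qed
  then have "shape F n k s \<in> closure (nef_shapes (kind F k))" by (simp add: closure_approachable)
  then show ?thesis using closed_nef_shapes[OF \<kappa>] by simp
qed

text \<open>
  In the discrete cases and for the gamma law the conditional support is that of \<open>nef_law\<close>, for
  which one-sided bounds suffice: integrality, the number of trials as an upper bound, and zero
  as a lower bound without mass.
\<close>

lemma admissible_nef_admissible:
  assumes n: "1 \<le> n" and F: "valid_family d F" and adm: "admissible n d F s" and k: "k \<in> {1..d}"
  shows "nef_admissible (kind F k) (shape F n k s) (s k)"
proof (cases "kind F k = Norm")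
  case True
  then show ?thesis by simp
next
  case \<kappa>: False
  obtain \<phi> where \<phi>: "\<phi> \<in> par_space d F" using par_space_nonempty by blast
  let ?c = "shape F n k s"
  note c = admissible_discrete_shape[OF n F adm k \<kappa>]
  have S: "S_given n d F \<phi> k s A = measure (nef_law (kind F k) ?c (\<phi> k)) A" if "A \<in> sets borel" for A
    using \<kappa> that admissible_near_pos[OF adm F \<phi> k] by (intro S_given_eq_nef_law[OF n F \<phi> k _ c]) auto
  have supp: "cond_support n d F \<phi> k s = nef_support (kind F k) ?c (\<phi> k)"
    by (simp add: cond_support_def nef_support_def S)
  define a where "a = Inf (ereal ` cond_support n d F \<phi> k s)"
  define b where "b = Sup (ereal ` cond_support n d F \<phi> k s)"
  have sk: "s k \<in> nef_support (kind F k) ?c (\<phi> k)"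
    and ab: "if 0 < S_given n d F \<phi> k s {x. ereal x = a}
            then a \<le> ereal (s k) \<and> ereal (s k) < b
            else a < ereal (s k) \<and> ereal (s k) < b"
    using adm \<phi> k unfolding supp[symmetric] by (auto simp: admissible_def Let_def a_def b_def)
  show ?thesis
  proof (cases "kind F k")
    case Bin
    have "b \<le> ereal ?c"
      unfolding b_def supp using nef_support_Bin[of ?c "\<phi> k"] c Bin by (intro SUP_least) auto
    moreover have "ereal (s k) < b" using ab by (auto split: if_splits)
    ultimately have "s k < ?c" by (metis ereal_less_eq(3) le_less_trans less_ereal.simps(1) order_less_le_trans)
    then show ?thesis using Bin nef_support_Nats[of Bin] sk by auto
  next
    case Gam
    have "0 \<le> a"
      unfolding a_def supp using nef_support_Gam[of ?c "\<phi> k"] Gam by (intro INF_greatest) auto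
    obtain r where r: "{x. ereal x = a} \<subseteq> {r}" by (cases a) auto
    have "finite {x. ereal x = a}" by (rule finite_subset[OF r]) simp
    then have "{x. ereal x = a} \<in> sets borel" by (intro borel_closed finite_imp_closed)
    note this Gam_law_null[OF this disjI2[OF r], of ?c "\<phi> k"]
    then have "S_given n d F \<phi> k s {x. ereal x = a} = 0"
      using Gam by (simp add: S del: nef_law.simps)
    with ab have "a < ereal (s k)" by simp
    with \<open>0 \<le> a\<close> have "0 < ereal (s k)" by (rule le_less_trans)
    then show ?thesis using Gam by (simp add: zero_ereal_def)
  qed (use sk nef_support_Nats[of "kind F k"] \<kappa> in auto)
qed

text \<open>
  For a normal component that follows a gamma component, the parameter is the observed sum of the gamma
  components, which admissibility at that component makes positive.
\<close>

lemma admissible_shape_in_nef_shapes: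
  assumes n: "1 \<le> n" and F: "valid_family d F" and adm: "admissible n d F s" and k: "k \<in> {1..d}"
  shows "shape F n k s \<in> nef_shapes (kind F k)"
proof (cases "kind F k = Norm")
  case True
  show ?thesis
  proof (cases F)
    case (NM_Gamma_Normal m R)
    then have "m + 1 \<in> {1..d}" and km: "\<not> k \<le> m + 1" using F True by (auto split: if_splits)
    from admissible_nef_admissible[OF n F adm this(1)] show ?thesis
      using NM_Gamma_Normal km by simp
  qed (use True n F in \<open>auto split: if_splits\<close>)
qed (rule admissible_discrete_shape[OF n F adm k])

section \<open>The fiducial density\<close>

lemma cond_cdf_eq:
  assumes n: "1 \<le> n" and F: "valid_family d F" and adm: "admissible n d F s" and k: "k \<in> {1..d}"
    and \<phi>: "\<phi> \<in> par_space d F" and t: "t \<in> par_range F k"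
  shows "cond_cdf n d F s k \<phi> t = measure (nef_law (kind F k) (shape F n k s) t) {..s k}"
proof -
  have \<phi>': "\<phi>(k := t) \<in> par_space d F"
    using \<phi> t k by (auto simp: par_space_def PiE_iff extensional_def)
  show ?thesis
    unfolding cond_cdf_def
    by (subst S_given_eq_nef_law[OF n F \<phi>' k admissible_near_pos[OF adm F \<phi>' k] admissible_shape_in_nef_shapes[OF n F adm k]]) auto
qed

lemma fiducial_factor_eq:
  assumes n: "1 \<le> n" and F: "valid_family d F" and adm: "admissible n d F s" and k: "k \<in> {1..d}"
  shows "\<exists>C>0. (\<forall>\<phi>\<in>par_space d F. \<forall>t\<in>par_range F k. (cond_cdf n d F s k \<phi> has_real_derivative
        - (C * nef_fid (kind F k) (shape F n k s) (s k) t)) (at t)) \<and>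
     (\<integral>\<^sup>+t. ennreal (C * nef_fid (kind F k) (shape F n k s) (s k) t) * indicator (par_range F k) t \<partial>lborel) = 1"
proof -
  obtain C where C: "0 < C"
    and D: "\<And>t. t \<in> par_range F k \<Longrightarrow> ((\<lambda>t. measure (nef_law (kind F k) (shape F n k s) t) {..s k})
        has_real_derivative - (C * nef_fid (kind F k) (shape F n k s) (s k) t)) (at t)"
    and I: "(\<integral>\<^sup>+t. ennreal (C * nef_fid (kind F k) (shape F n k s) (s k) t) * indicator (par_range F k) t \<partial>lborel) = 1"
    using nef_fiducial[OF admissible_shape_in_nef_shapes[OF n F adm k] admissible_nef_admissible[OF n F adm k]]
    unfolding par_range_eq_nef_pars by blast
  have "(cond_cdf n d F s k \<phi> has_real_derivative - (C * nef_fid (kind F k) (shape F n k s) (s k) t)) (at t)"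
    if \<phi>: "\<phi> \<in> par_space d F" and t: "t \<in> par_range F k" for \<phi> t
    using D[OF t]
  proof (rule has_field_derivative_transform_within_open)
    show "open (par_range F k)" by (simp add: par_range_eq_nef_pars open_nef_pars)
    show "measure (nef_law (kind F k) (shape F n k s) t') {..s k} = cond_cdf n d F s k \<phi> t'"
      if "t' \<in> par_range F k" for t'
      by (rule cond_cdf_eq[OF n F adm k \<phi> that, symmetric])
  qed (rule t)
  with C I show ?thesis by blast
qed

text \<open>
  The common form of all families, in terms of the five exponential families.
\<close>

theorem fiducial_density_nef:
  assumes n: "1 \<le> n" and F: "valid_family d F" and adm: "admissible n d F s"
  shows "fiducial_well_defined n d F s"
    and "prob_space (fiducial_distribution n d F s)"
    and "proportional_on (par_space d F) (fiducial_density n d F s)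
           (\<lambda>\<phi>. \<Prod>k=1..d. nef_fid (kind F k) (shape F n k s) (s k) (\<phi> k))"
proof -
  let ?h = "\<lambda>k. nef_fid (kind F k) (shape F n k s) (s k)"
  have "\<forall>k\<in>{1..d}. \<exists>C>0. (\<forall>\<phi>\<in>par_space d F. \<forall>t\<in>par_range F k.
        (cond_cdf n d F s k \<phi> has_real_derivative - (C * ?h k t)) (at t)) \<and>
     (\<integral>\<^sup>+t. ennreal (C * ?h k t) * indicator (par_range F k) t \<partial>lborel) = 1"
    using fiducial_factor_eq[OF n F adm] by (rule ballI)
  from bchoice[OF this] obtain C where *: "\<forall>k\<in>{1..d}. 0 < C k \<and>
     (\<forall>\<phi>\<in>par_space d F. \<forall>t\<in>par_range F k.
        (cond_cdf n d F s k \<phi> has_real_derivative - (C k * ?h k t)) (at t)) \<and>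
     (\<integral>\<^sup>+t. ennreal (C k * ?h k t) * indicator (par_range F k) t \<partial>lborel) = 1"
    by (rule exE)
  have C: "0 < C k"
    and I: "(\<integral>\<^sup>+t. ennreal (C k * ?h k t) * indicator (par_range F k) t \<partial>lborel) = 1"
    if "k \<in> {1..d}" for k
    using bspec[OF * that] by (simp_all only:)
  have D: "(cond_cdf n d F s k \<phi> has_real_derivative - (C k * ?h k t)) (at t)"
    if "k \<in> {1..d}" "\<phi> \<in> par_space d F" "t \<in> par_range F k" for k \<phi> t
    using bspec[OF * that(1)] that(2,3) by blast
  show "fiducial_well_defined n d F s"
    unfolding fiducial_well_defined_def
  proof (intro ballI conjI)
    fix k \<phi> t \<phi>'
    assume k: "k \<in> {1..d}" and \<phi>: "\<phi> \<in> par_space d F" and t: "t \<in> par_range F k"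
    show "cond_cdf n d F s k \<phi> differentiable (at t)"
      using D[OF k \<phi> t] unfolding real_differentiable_def by (rule exI)
    assume \<phi>': "\<phi>' \<in> par_space d F"
    show "cond_cdf n d F s k \<phi>' t = cond_cdf n d F s k \<phi> t"
      using cond_cdf_eq[OF n F adm k \<phi> t] cond_cdf_eq[OF n F adm k \<phi>' t] by simp
  qed
  have factor: "fiducial_factor n d F s k \<phi> = C k * ?h k (\<phi> k)" if "k \<in> {1..d}" "\<phi> \<in> par_space d F" for k \<phi>
    using DERIV_imp_deriv[OF D[OF that, of "\<phi> k"]] that par_spaceD[OF that(2)]
    by (simp add: fiducial_factor_def)
  have density: "fiducial_density n d F s \<phi> = (\<Prod>k=1..d. C k * ?h k (\<phi> k))" if "\<phi> \<in> par_space d F" for \<phi>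
    unfolding fiducial_density_def using factor that by (intro prod.cong) auto
  show "proportional_on (par_space d F) (fiducial_density n d F s) (\<lambda>\<phi>. \<Prod>k=1..d. ?h k (\<phi> k))"
    unfolding proportional_on_def
    using C by (intro exI[of _ "\<Prod>k=1..d. C k"] conjI prod_pos ballI) (auto simp: density prod.distrib)
  show "prob_space (fiducial_distribution n d F s)"
  proof (rule prob_spaceI)
    interpret product_sigma_finite "\<lambda>_::nat. lborel :: real measure"
      by (rule product_sigma_finite.intro) (rule sigma_finite_lborel)
    let ?L = "PiM {1..d} (\<lambda>_. lborel :: real measure)"
    let ?g = "\<lambda>k t. ennreal (C k * ?h k t) * indicator (par_range F k) t"
    have g[measurable]: "?g k \<in> borel_measurable lborel" for k
      by (intro borel_measurable_times_ennreal measurable_compose[OF _ measurable_ennreal]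
            borel_measurable_times borel_measurable_const borel_measurable_indicator)
         (simp_all add: par_range_eq_nef_pars open_nef_pars borel_open)
    have eq: "ennreal (fiducial_density n d F s \<phi>) * indicator (par_space d F) \<phi> = (\<Prod>k=1..d. ?g k (\<phi> k))"
      if "\<phi> \<in> space ?L" for \<phi>
    proof (cases "\<phi> \<in> par_space d F")
      case True
      have "(\<Prod>k=1..d. ?g k (\<phi> k)) = (\<Prod>k=1..d. ennreal (C k * ?h k (\<phi> k)))"
        using par_spaceD[OF True] by (intro prod.cong) auto
      also have "\<dots> = ennreal (\<Prod>k=1..d. C k * ?h k (\<phi> k))"
        using C by (intro prod_ennreal mult_nonneg_nonneg nef_fid_nonneg) (simp add: less_imp_le)
      finally show ?thesis using True by (simp add: density)
    next
      case False
      moreover have "\<phi> \<in> extensional {1..d}" using that by (simp add: space_PiM PiE_def)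
      ultimately obtain k where "k \<in> {1..d}" "\<phi> k \<notin> par_range F k"
        by (auto simp: par_space_def PiE_iff)
      then have "(\<Prod>k=1..d. ?g k (\<phi> k)) = 0" by (intro prod_zero bexI[of _ k]) auto
      with False show ?thesis by simp
    qed
    have "fiducial_distribution n d F s = density ?L (\<lambda>\<phi>. \<Prod>k=1..d. ?g k (\<phi> k))"
      unfolding fiducial_distribution_def density_def
      by (intro arg_cong[where f = "measure_of _ _"] ext nn_integral_cong_simp) (simp add: eq)
    moreover have "emeasure (density ?L (\<lambda>\<phi>. \<Prod>k=1..d. ?g k (\<phi> k))) (space ?L) = 1"
    proof -
      have "(\<lambda>\<phi>. \<Prod>k=1..d. ?g k (\<phi> k)) \<in> borel_measurable ?L"
      proof (rule borel_measurable_prod_ennreal)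
        fix k assume "k \<in> {1..d}"
        then have "(\<lambda>\<phi>. \<phi> k) \<in> ?L \<rightarrow>\<^sub>M lborel" by (rule measurable_component_singleton)
        from measurable_compose[OF this g[of k]] show "(\<lambda>\<phi>. ?g k (\<phi> k)) \<in> borel_measurable ?L" .
      qed
      then have "emeasure (density ?L (\<lambda>\<phi>. \<Prod>k=1..d. ?g k (\<phi> k))) (space ?L) = (\<integral>\<^sup>+\<phi>. (\<Prod>k=1..d. ?g k (\<phi> k)) \<partial>?L)"
        by (subst emeasure_density) (auto intro!: nn_integral_cong)
      also have "\<dots> = (\<Prod>k=1..d. \<integral>\<^sup>+t. ?g k t \<partial>lborel)"
        using g by (intro product_nn_integral_prod) auto
      also have "\<dots> = 1" using I by (intro prod.neutral) auto
      finally show ?thesis .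
    qed
    ultimately show "emeasure (fiducial_distribution n d F s) (space (fiducial_distribution n d F s)) = 1"
      by simp
  qed
qed

theorem proposition7:
  fixes n d :: nat and F :: family and s :: "nat \<Rightarrow> real"
  assumes "1 \<le> n" and "1 \<le> d" and "valid_family d F"
    and "admissible n d F s"
  shows "fiducial_well_defined n d F s \<and>
    prob_space (fiducial_distribution n d F s) \<and>
    (\<not> is_NM_Gamma_Normal F \<longrightarrow>
       proportional_on (par_space d F) (fiducial_density n d F s)
         (\<lambda>\<phi>. \<Prod>k=1..d. exp (\<phi> k * (s k + z_const F k)
                - (real n + q_const F * ((\<Sum>j=1..k-1. s j) - 1)) * B_fun F k (\<phi> k)))) \<and>
    (\<forall>m R. F = NM_Gamma_Normal m R \<longrightarrow>
       proportional_on (par_space d F) (fiducial_density n d F s)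
         (\<lambda>\<phi>. (\<Prod>k=1..m. exp (\<phi> k * (s k + 1)) *
                  (1 - exp (\<phi> k)) powr (real n / q_const F + (\<Sum>j=1..k-1. s j) - 1)) *
               (exp (\<phi> (m + 1) * s (m + 1)) *
                  (- \<phi> (m + 1)) powr (real n / q_const F + (\<Sum>j=1..m. s j) - 1)) *
               (\<Prod>k=m+2..d. exp (\<phi> k * s k - s (m + 1) * (\<phi> k)\<^sup>2 / 2))))"
proof -
  note F = assms(3)
  note main = fiducial_density_nef[OF assms(1,3,4)]
  have prop_cong: "proportional_on (par_space d F) (fiducial_density n d F s) g"
    if "\<And>\<phi>. \<phi> \<in> par_space d F \<Longrightarrow> (\<Prod>k=1..d. nef_fid (kind F k) (shape F n k s) (s k) (\<phi> k)) = g \<phi>" for g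
    using main(3) that by (auto simp: proportional_on_def)
  have prefix: "(\<Sum>j=1..k-1. s j) = prefix_sum s k" if "1 \<le> k" for k
  proof -
    have "{1..k - 1} = {1..<k}" using that by auto
    then show ?thesis by (simp add: prefix_sum_def)
  qed
  have "proportional_on (par_space d F) (fiducial_density n d F s)
         (\<lambda>\<phi>. \<Prod>k=1..d. exp (\<phi> k * (s k + z_const F k)
                - (real n + q_const F * ((\<Sum>j=1..k-1. s j) - 1)) * B_fun F k (\<phi> k)))"
    if nF: "\<not> is_NM_Gamma_Normal F"
  proof (intro prop_cong prod.cong refl)
    fix \<phi> k assume "\<phi> \<in> par_space d F" "k \<in> {1..d}"
    then have k: "1 \<le> k" by simp
    show "nef_fid (kind F k) (shape F n k s) (s k) (\<phi> k) = exp (\<phi> k * (s k + z_const F k)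
                - (real n + q_const F * ((\<Sum>j=1..k-1. s j) - 1)) * B_fun F k (\<phi> k))"
      unfolding prefix[OF k]
    proof (cases F)
      case (Poisson_Normal m \<sigma>)
      then show "nef_fid (kind F k) (shape F n k s) (s k) (\<phi> k) = exp (\<phi> k * (s k + z_const F k)
                - (real n + q_const F * (prefix_sum s k - 1)) * B_fun F k (\<phi> k))" by simp
    next
      case (Multinomial N)
      then have "N \<noteq> 0" using F by auto
      then have "(real n + - 1 / real N * (prefix_sum s k - 1)) * (real N * L) = (real n * real N - prefix_sum s k + 1) * L" for L
        by (simp add: field_simps)
      then show "nef_fid (kind F k) (shape F n k s) (s k) (\<phi> k) = exp (\<phi> k * (s k + z_const F k)
                - (real n + q_const F * (prefix_sum s k - 1)) * B_fun F k (\<phi> k))"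
        by (simp only: Multinomial kind.simps shape.simps nef_fid.simps q_const.simps z_const.simps B_fun.simps)
    next
      case (Neg_Multinomial R)
      then have "R \<noteq> 0" using F by auto
      then have "a - (real n + 1 / real R * (prefix_sum s k - 1)) * (- real R * L)
          = a + (real n * real R + prefix_sum s k - 1) * L" for a L
        by (simp add: field_simps)
      then show "nef_fid (kind F k) (shape F n k s) (s k) (\<phi> k) = exp (\<phi> k * (s k + z_const F k)
                - (real n + q_const F * (prefix_sum s k - 1)) * B_fun F k (\<phi> k))"
        by (simp only: Neg_Multinomial kind.simps shape.simps nef_fid.simps q_const.simps z_const.simps B_fun.simps)
    next
      case (NM_Gamma_Normal m R)
      then show "nef_fid (kind F k) (shape F n k s) (s k) (\<phi> k) = exp (\<phi> k * (s k + z_const F k)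
                - (real n + q_const F * (prefix_sum s k - 1)) * B_fun F k (\<phi> k))"
        using nF by (auto simp: is_NM_Gamma_Normal_def)
    qed
  qed
  moreover have "proportional_on (par_space d F) (fiducial_density n d F s)
         (\<lambda>\<phi>. (\<Prod>k=1..m. exp (\<phi> k * (s k + 1)) *
                  (1 - exp (\<phi> k)) powr (real n / q_const F + (\<Sum>j=1..k-1. s j) - 1)) *
               (exp (\<phi> (m + 1) * s (m + 1)) *
                  (- \<phi> (m + 1)) powr (real n / q_const F + (\<Sum>j=1..m. s j) - 1)) *
               (\<Prod>k=m+2..d. exp (\<phi> k * s k - s (m + 1) * (\<phi> k)\<^sup>2 / 2)))"
    if Fm: "F = NM_Gamma_Normal m R" for m R
  proof (rule prop_cong)
    fix \<phi> assume \<phi>: "\<phi> \<in> par_space d F"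
    let ?h = "\<lambda>k. nef_fid (kind F k) (shape F n k s) (s k) (\<phi> k)"
    have m: "m + 1 \<le> d" using F Fm by simp
    have split: "{1..d} = {1..m} \<union> ({m + 1} \<union> {m + 2..d})" using m by auto
    have "(\<Prod>k=1..d. ?h k) = (\<Prod>k=1..m. ?h k) * (?h (m + 1) * (\<Prod>k=m+2..d. ?h k))"
      unfolding split by (subst prod.union_disjoint, auto)+
    also have "(\<Prod>k=1..m. ?h k) = (\<Prod>k=1..m. exp (\<phi> k * (s k + 1)) *
                  (1 - exp (\<phi> k)) powr (real n / q_const F + (\<Sum>j=1..k-1. s j) - 1))"
    proof (rule prod.cong)
      fix k assume k: "k \<in> {1..m}"
      then have "\<phi> k < 0" using bspec[OF par_spaceD[OF \<phi>], of k] m Fm by simp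
      then show "?h k = exp (\<phi> k * (s k + 1)) * (1 - exp (\<phi> k)) powr (real n / q_const F + (\<Sum>j=1..k-1. s j) - 1)"
        using k Fm prefix[of k] by (simp add: exp_add powr_def)
    qed simp
    also have "?h (m + 1) = exp (\<phi> (m + 1) * s (m + 1)) * (- \<phi> (m + 1)) powr (real n / q_const F + (\<Sum>j=1..m. s j) - 1)"
      using Fm prefix[of "m + 1"] by simp
    also have "(\<Prod>k=m+2..d. ?h k) = (\<Prod>k=m+2..d. exp (\<phi> k * s k - s (m + 1) * (\<phi> k)\<^sup>2 / 2))"
      using Fm by (intro prod.cong) auto
    finally show "(\<Prod>k=1..d. ?h k) = (\<Prod>k=1..m. exp (\<phi> k * (s k + 1)) *
                  (1 - exp (\<phi> k)) powr (real n / q_const F + (\<Sum>j=1..k-1. s j) - 1)) *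
               (exp (\<phi> (m + 1) * s (m + 1)) *
                  (- \<phi> (m + 1)) powr (real n / q_const F + (\<Sum>j=1..m. s j) - 1)) *
               (\<Prod>k=m+2..d. exp (\<phi> k * s k - s (m + 1) * (\<phi> k)\<^sup>2 / 2))"
      by (simp only: mult.assoc)
  qed
  ultimately show ?thesis using main(1,2) by blast
qed

end
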